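(* Let $\mathcal T$ be an FLD$_1$-theory, $\sum_{\mathbb I}\mathbb X_i\in\mathcal D(\mathcal T)$, and suppose $I(\mathbb X_i)>\omega$ for some $i\in I$. Then $I(\mathcal T)\ge\prod_{i\in I}I(\mathbb X_i)\in\{\omega_1,\mathfrak c\}$.
   Context: All structures are partial orders in the language $L_b=\langle\le\rangle$; $\mathfrak c=2^{\aleph_0}$. For a complete $L_b$-theory $\mathcal T$, $I(\mathcal T)$ is the number of non-isomorphic countable models of $\mathcal T$; for a partial order $\mathbb X$, $I(\mathbb X):=I(\mathrm{Th}(\mathbb X))$, with $I(\mathbb X)=1$ when $\mathbb X$ is finite. Lexicographic sum: for a partial order $\mathbb I=\langle I,\le_{\mathbb I}\rangle$ and partial orders $\mathbb X_i$ ($i\in I$) with pairwise disjoint domains, $\sum_{\mathbb I}\mathbb X_i$ is the partial order on $\bigcup_i X_i$ with $x\le x'$ iff either $x,x'\in X_i$ and $x\le_{\mathbb X_i}x'$, or $x\in X_i$, $x'\in X_j$ with $i<_{\mathbb I}j$. A partial order $\mathbb X$ is FLD$_1$ iff $\mathbb X=\sum_{\mathbb I}\mathbb X_i$ for some finite partial order $\mathbb I$ and partition $\{X_i\}_{i\in I}$ of its domain (induced suborders $\mathbb X_i$) with each $\mathbb X_i$ having a largest element; this is an FLD$_1$ decomposition. A complete theory of partial order is an FLD$_1$-theory iff some (equivalently every) model is FLD$_1$. $\mathcal D(\mathcal T)$ is the class of all FLD$_1$ decompositions of models of $\mathcal T$. *)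

theory Defs
  imports "HOL-Library.Countable_Set" "HOL-Library.FuncSet" "HOL-Library.Disjoint_Sets"
begin

unbundle cardinal_syntax

section \<open>First-order logic in the language of one binary relation\<close>

datatype fm = Eq nat nat | Leq nat nat | Neg fm | Conj fm fm | Ex nat fm

instance fm :: countable
  by countable_datatype

abbreviation All :: "nat \<Rightarrow> fm \<Rightarrow> fm" where
  "All x \<phi> \<equiv> Neg (Ex x (Neg \<phi>))"

abbreviation Impl :: "fm \<Rightarrow> fm \<Rightarrow> fm" where
  "Impl \<phi> \<psi> \<equiv> Neg (Conj \<phi> (Neg \<psi>))"

primrec fv :: "fm \<Rightarrow> nat set" where
  "fv (Eq x y) = {x, y}"
| "fv (Leq x y) = {x, y}"
| "fv (Neg \<phi>) = fv \<phi>"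
| "fv (Conj \<phi> \<psi>) = fv \<phi> \<union> fv \<psi>"
| "fv (Ex x \<phi>) = fv \<phi> - {x}"

definition sentences :: "fm set" where
  "sentences = {\<phi>. fv \<phi> = {}}"

text \<open>A structure is a pair of a domain and a binary relation.\<close>

type_synonym 'a struct = "'a set \<times> 'a rel"

abbreviation dom_of :: "'a struct \<Rightarrow> 'a set" where "dom_of \<equiv> fst"
abbreviation le_of :: "'a struct \<Rightarrow> 'a rel" where "le_of \<equiv> snd"

definition is_struct :: "'a struct \<Rightarrow> bool" where
  "is_struct X \<longleftrightarrow> dom_of X \<noteq> {} \<and> le_of X \<subseteq> dom_of X \<times> dom_of X"

primrec sat :: "'a struct \<Rightarrow> (nat \<Rightarrow> 'a) \<Rightarrow> fm \<Rightarrow> bool" where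
  "sat X e (Eq x y) \<longleftrightarrow> e x = e y"
| "sat X e (Leq x y) \<longleftrightarrow> (e x, e y) \<in> le_of X"
| "sat X e (Neg \<phi>) \<longleftrightarrow> \<not> sat X e \<phi>"
| "sat X e (Conj \<phi> \<psi>) \<longleftrightarrow> sat X e \<phi> \<and> sat X e \<psi>"
| "sat X e (Ex x \<phi>) \<longleftrightarrow> (\<exists>a\<in>dom_of X. sat X (e(x := a)) \<phi>)"

definition holds :: "'a struct \<Rightarrow> fm \<Rightarrow> bool" where
  "holds X \<phi> \<longleftrightarrow> (\<forall>e. range e \<subseteq> dom_of X \<longrightarrow> sat X e \<phi>)"

definition is_model :: "'a struct \<Rightarrow> fm set \<Rightarrow> bool" where
  "is_model X T \<longleftrightarrow> is_struct X \<and> (\<forall>\<phi>\<in>T. holds X \<phi>)"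

definition Th :: "'a struct \<Rightarrow> fm set" where
  "Th X = {\<phi> \<in> sentences. holds X \<phi>}"

definition is_iso :: "'a struct \<Rightarrow> 'b struct \<Rightarrow> ('a \<Rightarrow> 'b) \<Rightarrow> bool" where
  "is_iso X Y f \<longleftrightarrow> bij_betw f (dom_of X) (dom_of Y) \<and>
     (\<forall>x\<in>dom_of X. \<forall>y\<in>dom_of X. (x, y) \<in> le_of X \<longleftrightarrow> (f x, f y) \<in> le_of Y)"

definition isomorphic :: "'a struct \<Rightarrow> 'b struct \<Rightarrow> bool" (infix \<open>\<cong>\<^sub>s\<close> 50) where
  "X \<cong>\<^sub>s Y \<longleftrightarrow> (\<exists>f. is_iso X Y f)"

text \<open>
  A definition cannot quantify over all types. In entailment, completeness and \<open>FLD\<^sub>1\<close>-theories,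
  models therefore range over the domains contained in \<^typ>\<open>nat\<close>; as the language is countable,
  the Loewenheim-Skolem theorem makes this immaterial (\<open>entails_model\<close>, \<open>model_nat\<close> and
  \<open>FLD1_theoryI\<close> below).
\<close>

definition entails :: "fm set \<Rightarrow> fm \<Rightarrow> bool" where
  "entails T \<phi> \<longleftrightarrow> (\<forall>X :: nat struct. is_model X T \<longrightarrow> holds X \<phi>)"

definition complete_theory :: "fm set \<Rightarrow> bool" where
  "complete_theory T \<longleftrightarrow> T \<subseteq> sentences \<and> (\<exists>X :: nat struct. is_model X T) \<and>
     (\<forall>\<phi>\<in>sentences. entails T \<phi> \<or> entails T (Neg \<phi>))"

definition po_axioms :: "fm set" where
  "po_axioms =
     {All 0 (Leq 0 0),
      All 0 (All 1 (Impl (Conj (Leq 0 1) (Leq 1 0)) (Eq 0 1))),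
      All 0 (All 1 (All 2 (Impl (Conj (Leq 0 1) (Leq 1 2)) (Leq 0 2))))}"

section \<open>The number of countable models\<close>

text \<open>
  Every countable structure is isomorphic to one whose domain is a set of natural numbers, so the
  classes below represent all isomorphism types of (finite or countably infinite) models. For a
  finite structure this gives the number 1 (\<open>num_models_of_finite\<close> below).
\<close>

definition iso_rel :: "nat struct rel" where
  "iso_rel = {(X, Y). X \<cong>\<^sub>s Y}"

definition num_models :: "fm set \<Rightarrow> nat struct set rel" where
  "num_models T = |{X :: nat struct. is_model X T} // iso_rel|"

definition num_models_of :: "'a struct \<Rightarrow> nat struct set rel" where
  "num_models_of X = num_models (Th X)"

text \<open>The product of a family of cardinals, generalising the binary product \<open>*c\<close>.\<close>

definition Cprod :: "'i set \<Rightarrow> ('i \<Rightarrow> 'b rel) \<Rightarrow> ('i \<Rightarrow> 'b) rel" where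
  "Cprod I \<kappa> = |\<Pi>\<^sub>E i\<in>I. Field (\<kappa> i)|"

section \<open>Lexicographic sums and \<open>FLD\<^sub>1\<close> decompositions\<close>

definition is_po :: "'a struct \<Rightarrow> bool" where
  "is_po X \<longleftrightarrow> partial_order_on (dom_of X) (le_of X)"

definition has_largest :: "'a struct \<Rightarrow> bool" where
  "has_largest X \<longleftrightarrow> (\<exists>m\<in>dom_of X. \<forall>x\<in>dom_of X. (x, m) \<in> le_of X)"

definition lex_sum :: "'i struct \<Rightarrow> ('i \<Rightarrow> 'a struct) \<Rightarrow> 'a struct" where
  "lex_sum I X =
     (\<Union>i\<in>dom_of I. dom_of (X i),
      {(x, y). (\<exists>i\<in>dom_of I. x \<in> dom_of (X i) \<and> y \<in> dom_of (X i) \<and> (x, y) \<in> le_of (X i)) \<or>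
               (\<exists>i\<in>dom_of I. \<exists>j\<in>dom_of I. i \<noteq> j \<and> (i, j) \<in> le_of I \<and>
                  x \<in> dom_of (X i) \<and> y \<in> dom_of (X j))})"

text \<open>
  The summands are the induced suborders of the sum (\<open>lex_sum_induced\<close> below), and they are
  nonempty because they have largest elements.
\<close>

definition FLD1_decomp :: "'i struct \<Rightarrow> ('i \<Rightarrow> 'a struct) \<Rightarrow> bool" where
  "FLD1_decomp I X \<longleftrightarrow>
     finite (dom_of I) \<and> is_po I \<and>
     (\<forall>i\<in>dom_of I. is_po (X i) \<and> has_largest (X i)) \<and>
     disjoint_family_on (\<lambda>i. dom_of (X i)) (dom_of I)"

text \<open>Finite index orders may be taken on natural numbers.\<close>

definition FLD1 :: "'a struct \<Rightarrow> bool" where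
  "FLD1 Y \<longleftrightarrow> (\<exists>(I :: nat struct) X. FLD1_decomp I X \<and> Y = lex_sum I X)"

definition FLD1_theory :: "fm set \<Rightarrow> bool" where
  "FLD1_theory T \<longleftrightarrow> complete_theory T \<and> (\<forall>\<phi>\<in>po_axioms. entails T \<phi>) \<and>
     (\<exists>Y :: nat struct. is_model Y T \<and> FLD1 Y)"

definition FLD1_decomps :: "fm set \<Rightarrow> ('i struct \<times> ('i \<Rightarrow> 'a struct)) set" where
  "FLD1_decomps T = {(I, X). FLD1_decomp I X \<and> is_model (lex_sum I X) T}"

section \<open>Basic facts\<close>

lemma isomorphic_refl: "X \<cong>\<^sub>s X"
  unfolding isomorphic_def is_iso_def by (auto intro!: exI[of _ id])

lemma isomorphic_sym:
  assumes "X \<cong>\<^sub>s Y"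
  shows "Y \<cong>\<^sub>s X"
proof -
  obtain f where f: "bij_betw f (dom_of X) (dom_of Y)"
    and r: "\<forall>x\<in>dom_of X. \<forall>y\<in>dom_of X. (x, y) \<in> le_of X \<longleftrightarrow> (f x, f y) \<in> le_of Y"
    using assms by (auto simp: isomorphic_def is_iso_def)
  have "is_iso Y X (inv_into (dom_of X) f)"
    unfolding is_iso_def
    using r bij_betw_inv_into[OF f] bij_betw_inv_into_right[OF f] bij_betwE[OF bij_betw_inv_into[OF f]]
    by auto
  then show ?thesis by (auto simp: isomorphic_def)
qed

lemma isomorphic_trans:
  assumes "X \<cong>\<^sub>s Y" "Y \<cong>\<^sub>s Z"
  shows "X \<cong>\<^sub>s Z"
proof -
  obtain f g where "is_iso X Y f" "is_iso Y Z g"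
    using assms by (auto simp: isomorphic_def)
  then have "is_iso X Z (g \<circ> f)"
    unfolding is_iso_def by (auto intro: bij_betw_trans dest: bij_betwE)
  then show ?thesis by (auto simp: isomorphic_def)
qed

lemma equiv_iso_rel: "equiv UNIV iso_rel"
  by (rule equivI)
    (auto simp: iso_rel_def refl_on_def isomorphic_refl
      intro!: symI transI intro: isomorphic_sym isomorphic_trans)

lemma sat_cong: "(\<And>x. x \<in> fv \<phi> \<Longrightarrow> e x = e' x) \<Longrightarrow> sat X e \<phi> \<longleftrightarrow> sat X e' \<phi>"
proof (induction \<phi> arbitrary: e e')
  case (Conj \<phi> \<psi>)
  then show ?case by (metis UnCI fv.simps(4) sat.simps(4))
next
  case (Neg \<phi>)
  then show ?case by (metis fv.simps(3) sat.simps(3))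
next
  case (Ex x \<phi>)
  have "sat X (e(x := a)) \<phi> \<longleftrightarrow> sat X (e'(x := a)) \<phi>" for a
    using Ex.prems by (intro Ex.IH) auto
  then show ?case by simp
qed auto

lemma holds_sentence:
  assumes "\<phi> \<in> sentences" "range e \<subseteq> dom_of X"
  shows "holds X \<phi> \<longleftrightarrow> sat X e \<phi>"
  using assms sat_cong[of \<phi> _ e X] unfolding holds_def sentences_def by auto

lemma holds_Neg:
  assumes "\<phi> \<in> sentences" "is_struct X"
  shows "holds X (Neg \<phi>) \<longleftrightarrow> \<not> holds X \<phi>"
proof -
  obtain a where "a \<in> dom_of X" using assms(2) by (auto simp: is_struct_def)
  then have "range (\<lambda>_::nat. a) \<subseteq> dom_of X" by auto
  moreover have "Neg \<phi> \<in> sentences" using assms(1) by (simp add: sentences_def)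
  ultimately show ?thesis using assms(1) by (metis holds_sentence sat.simps(3))
qed

lemma sat_iso:
  assumes f: "is_iso X Y f"
  shows "range e \<subseteq> dom_of X \<Longrightarrow> sat Y (f \<circ> e) \<phi> \<longleftrightarrow> sat X e \<phi>"
proof (induction \<phi> arbitrary: e)
  case (Eq x y)
  then have "e x \<in> dom_of X" "e y \<in> dom_of X" by blast+
  then show ?case using f by (auto simp: is_iso_def bij_betw_def dest: inj_onD)
next
  case (Leq x y)
  then have "e x \<in> dom_of X" "e y \<in> dom_of X" by blast+
  then show ?case using f by (auto simp: is_iso_def)
next
  case (Ex x \<phi>)
  have im: "dom_of Y = f ` dom_of X" using f by (auto simp: is_iso_def bij_betw_def)
  have "sat Y ((f \<circ> e)(x := f a)) \<phi> \<longleftrightarrow> sat X (e(x := a)) \<phi>" if "a \<in> dom_of X" for a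
  proof -
    have "range (e(x := a)) \<subseteq> dom_of X" using Ex.prems that by auto
    then have "sat Y (f \<circ> e(x := a)) \<phi> \<longleftrightarrow> sat X (e(x := a)) \<phi>" by (rule Ex.IH)
    then show ?thesis by (simp add: fun_upd_comp)
  qed
  then show ?case by (simp add: im comp_def)
qed auto

lemma holds_iso:
  assumes "is_iso X Y f" "\<phi> \<in> sentences" "is_struct X"
  shows "holds Y \<phi> \<longleftrightarrow> holds X \<phi>"
proof -
  obtain a where a: "a \<in> dom_of X" using assms(3) by (auto simp: is_struct_def)
  then have r: "range (\<lambda>_::nat. a) \<subseteq> dom_of X" by auto
  then have "range (f \<circ> (\<lambda>_::nat. a)) \<subseteq> dom_of Y"
    using a assms(1) by (auto simp: is_iso_def dest: bij_betwE)
  then show ?thesis using sat_iso[OF assms(1) r] holds_sentence assms(2) r by metis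
qed

text \<open>Downward Loewenheim-Skolem: a countable elementary substructure containing a given countable set.\<close>

lemma fv_bounded: "\<exists>n. fv \<phi> \<subseteq> {..<n}"
  by (rule finite_nat_iff_bounded[THEN iffD1], induction \<phi>) auto

lemma loewenheim_skolem:
  fixes X :: "'a struct"
  assumes "is_struct X" "countable S" "S \<subseteq> dom_of X"
  obtains B where "countable B" "S \<subseteq> B" "B \<subseteq> dom_of X" "B \<noteq> {}"
    "\<And>e \<phi>. range e \<subseteq> B \<Longrightarrow> sat (B, le_of X \<inter> B \<times> B) e \<phi> \<longleftrightarrow> sat X e \<phi>"
proof -
  obtain a0 where a0: "a0 \<in> dom_of X" using assms(1) by (auto simp: is_struct_def)
  define env where "env l = (\<lambda>n. if n < length l then l ! n else a0)" for l
  define w where "w = (\<lambda>(\<phi>, x, l). if \<exists>a\<in>dom_of X. sat X ((env l)(x := a)) \<phi>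
      then SOME a. a \<in> dom_of X \<and> sat X ((env l)(x := a)) \<phi> else a0)"
  have w_dom: "w p \<in> dom_of X" for p
    unfolding w_def by (cases p) (auto simp: a0 intro: someI2_ex)
  have w_sat: "sat X ((env l)(x := w (\<phi>, x, l))) \<phi>"
    if "\<exists>a\<in>dom_of X. sat X ((env l)(x := a)) \<phi>" for \<phi> x l
    using that someI_ex[of "\<lambda>a. a \<in> dom_of X \<and> sat X ((env l)(x := a)) \<phi>"]
    unfolding w_def by auto
  define C where "C = rec_nat (insert a0 S) (\<lambda>_ B. B \<union> w ` (UNIV \<times> UNIV \<times> lists B))"
  have C0: "C 0 = insert a0 S"
    and CS: "C (Suc n) = C n \<union> w ` (UNIV \<times> UNIV \<times> lists (C n))" for n
    by (simp_all add: C_def)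
  have cC: "countable (C n)" for n
    by (induction n) (auto simp: C0 CS assms(2) intro!: countable_image countable_SIGMA)
  have mono: "C m \<subseteq> C n" if "m \<le> n" for m n
    using that by (induction rule: dec_induct) (auto simp: CS)
  have sub: "C n \<subseteq> dom_of X" for n
    by (induction n) (use a0 assms(3) w_dom in \<open>auto simp: C0 CS\<close>)
  define B where "B = (\<Union>n. C n)"
  have "a0 \<in> B" "S \<subseteq> B" using C0 unfolding B_def by blast+
  have Bsub: "B \<subseteq> dom_of X" using sub unfolding B_def by blast
  have lists_B: "\<exists>n. l \<in> lists (C n)" if "l \<in> lists B" for l
    using that
  proof (induction l)
    case (Cons a l)
    then obtain m n where "a \<in> C m" "l \<in> lists (C n)" unfolding B_def by auto
    then have "a # l \<in> lists (C (max m n))"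
      using mono[of m "max m n"] mono[of n "max m n"] by (auto simp: in_lists_conv_set)
    then show ?case ..
  qed auto
  have w_B: "w (\<phi>, x, l) \<in> B" if l: "l \<in> lists B" for \<phi> x l
  proof -
    obtain n where "l \<in> lists (C n)" using lists_B[OF l] ..
    then have "w (\<phi>, x, l) \<in> C (Suc n)" unfolding CS by blast
    then show ?thesis unfolding B_def by blast
  qed
  have elem: "sat (B, le_of X \<inter> B \<times> B) e \<phi> \<longleftrightarrow> sat X e \<phi>" if "range e \<subseteq> B" for e \<phi>
    using that
  proof (induction \<phi> arbitrary: e)
    case (Leq x y)
    then show ?case by auto
  next
    case (Ex x \<phi>)
    have IH: "sat (B, le_of X \<inter> B \<times> B) (e(x := a)) \<phi> \<longleftrightarrow> sat X (e(x := a)) \<phi>" if "a \<in> B" for a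
      using Ex.prems that by (intro Ex.IH) auto
    have "\<exists>a\<in>B. sat X (e(x := a)) \<phi>" if ex: "\<exists>a\<in>dom_of X. sat X (e(x := a)) \<phi>"
    proof -
      obtain n where n: "fv \<phi> \<subseteq> {..<n}" using fv_bounded by blast
      define l where "l = map e [0..<n]"
      have l: "l \<in> lists B" using Ex.prems unfolding l_def in_lists_conv_set by auto
      have eq: "sat X ((env l)(x := a)) \<phi> \<longleftrightarrow> sat X (e(x := a)) \<phi>" for a
        by (rule sat_cong) (use n in \<open>auto simp: env_def l_def\<close>)
      show ?thesis using ex w_sat[of l x \<phi>] w_B[OF l] unfolding eq by blast
    qed
    then show ?case using IH Bsub by auto
  qed auto
  show thesis
    by (rule that[of B]) (use cC \<open>a0 \<in> B\<close> \<open>S \<subseteq> B\<close> Bsub elem in \<open>auto simp: B_def\<close>)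
qed

definition image_struct :: "('a \<Rightarrow> 'b) \<Rightarrow> 'a struct \<Rightarrow> 'b struct" where
  "image_struct f X = (f ` dom_of X, map_prod f f ` le_of X)"

definition restr_struct :: "'a struct \<Rightarrow> 'a set \<Rightarrow> 'a struct" where
  "restr_struct X B = (dom_of X \<inter> B, le_of X \<inter> B \<times> B)"

lemma image_struct_is_struct: "is_struct X \<Longrightarrow> is_struct (image_struct f X)"
  unfolding image_struct_def is_struct_def by auto

lemma image_struct_le:
  assumes "inj_on f A" "le_of X \<subseteq> A \<times> A" "x \<in> A" "y \<in> A"
  shows "(f x, f y) \<in> map_prod f f ` le_of X \<longleftrightarrow> (x, y) \<in> le_of X"
proof
  assume "(f x, f y) \<in> map_prod f f ` le_of X"
  then obtain u v where "(u, v) \<in> le_of X" "f x = f u" "f y = f v" by auto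
  then show "(x, y) \<in> le_of X" using assms inj_onD[OF assms(1)] by (metis SigmaE2 subsetD)
qed (auto intro: rev_image_eqI)

lemma image_struct_iso:
  assumes "inj_on f (dom_of X)" "is_struct X"
  shows "is_iso X (image_struct f X) f"
  unfolding is_iso_def image_struct_def
  using assms image_struct_le[OF assms(1)]
  by (auto simp: is_struct_def inj_on_imp_bij_betw)

lemma countable_copy:
  fixes X :: "'a struct"
  assumes "is_struct X" "countable (dom_of X)"
  obtains Y :: "nat struct" and f where "is_struct Y" "is_iso X Y f"
  using image_struct_iso[OF inj_on_to_nat_on[OF assms(2)] assms(1)]
    image_struct_is_struct[OF assms(1)] by blast

lemma elementarily_equivalent_nat:
  fixes X :: "'a struct"
  assumes "is_struct X"
  shows "\<exists>Y :: nat struct. is_struct Y \<and> (\<forall>\<phi>\<in>sentences. holds Y \<phi> \<longleftrightarrow> holds X \<phi>)"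
proof -
  obtain B where B: "countable B" "B \<subseteq> dom_of X" "B \<noteq> {}"
    and el: "\<And>e \<phi>. range e \<subseteq> B \<Longrightarrow> sat (B, le_of X \<inter> B \<times> B) e \<phi> \<longleftrightarrow> sat X e \<phi>"
    using loewenheim_skolem[OF assms, of "{}"] by auto
  let ?Z = "(B, le_of X \<inter> B \<times> B)"
  have Z: "is_struct ?Z" using B by (auto simp: is_struct_def)
  obtain Y :: "nat struct" and f where Y: "is_struct Y" "is_iso ?Z Y f"
    using countable_copy[OF Z] B(1) by auto
  obtain b where b: "b \<in> B" using B by auto
  have "holds ?Z \<phi> \<longleftrightarrow> holds X \<phi>" if "\<phi> \<in> sentences" for \<phi>
    using el[of "\<lambda>_. b" \<phi>] holds_sentence[OF that, of "\<lambda>_. b" X]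
      holds_sentence[OF that, of "\<lambda>_. b" ?Z] b B(2) by auto
  then show ?thesis using holds_iso[OF Y(2) _ Z] Y(1) by blast
qed

lemma entails_model:
  fixes X :: "'a struct"
  assumes "entails T \<phi>" "is_model X T" "T \<subseteq> sentences" "\<phi> \<in> sentences"
  shows "holds X \<phi>"
  using elementarily_equivalent_nat[of X] assms unfolding entails_def is_model_def by blast

lemma model_nat:
  fixes X :: "'a struct"
  assumes "is_model X T" "T \<subseteq> sentences"
  shows "\<exists>Y :: nat struct. is_model Y T"
  using elementarily_equivalent_nat[of X] assms unfolding is_model_def by blast

lemma complete_theory_Th:
  fixes X :: "'a struct"
  assumes X: "is_struct X"
  shows "complete_theory (Th X)"
proof -
  have sub: "Th X \<subseteq> sentences" by (auto simp: Th_def)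
  have "is_model X (Th X)" using X by (auto simp: is_model_def Th_def)
  moreover have "entails (Th X) \<phi> \<or> entails (Th X) (Neg \<phi>)" if "\<phi> \<in> sentences" for \<phi>
  proof -
    have "Neg \<phi> \<in> sentences" using that by (simp add: sentences_def)
    then have "\<phi> \<in> Th X \<or> Neg \<phi> \<in> Th X" using that holds_Neg[OF that X] by (auto simp: Th_def)
    then show ?thesis by (auto simp: entails_def is_model_def)
  qed
  ultimately show ?thesis using model_nat sub unfolding complete_theory_def by blast
qed

lemma po_axioms_sentences: "po_axioms \<subseteq> sentences"
  by (auto simp: po_axioms_def sentences_def)

lemma holds_po_axioms:
  assumes "is_struct X"
  shows "(\<forall>\<phi>\<in>po_axioms. holds X \<phi>) \<longleftrightarrow> is_po X"
proof -
  obtain a where a: "a \<in> dom_of X" and sub: "le_of X \<subseteq> dom_of X \<times> dom_of X"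
    using assms by (auto simp: is_struct_def)
  have h: "holds X \<phi> \<longleftrightarrow> sat X (\<lambda>_. a) \<phi>" if "\<phi> \<in> po_axioms" for \<phi>
    by (rule holds_sentence) (use a that po_axioms_sentences in auto)
  have "(\<forall>\<phi>\<in>po_axioms. holds X \<phi>) \<longleftrightarrow> (\<forall>\<phi>\<in>po_axioms. sat X (\<lambda>_. a) \<phi>)"
    using h by blast
  also have "\<dots> \<longleftrightarrow> (\<forall>x\<in>dom_of X. (x, x) \<in> le_of X) \<and>
      (\<forall>x\<in>dom_of X. \<forall>y\<in>dom_of X. (x, y) \<in> le_of X \<longrightarrow> (y, x) \<in> le_of X \<longrightarrow> x = y) \<and>
      (\<forall>x\<in>dom_of X. \<forall>y\<in>dom_of X. \<forall>z\<in>dom_of X.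
        (x, y) \<in> le_of X \<longrightarrow> (y, z) \<in> le_of X \<longrightarrow> (x, z) \<in> le_of X)"
    unfolding po_axioms_def by simp blast
  also have "\<dots> \<longleftrightarrow> is_po X"
    unfolding is_po_def partial_order_on_def preorder_on_def refl_on_def antisym_def trans_def
    using sub by blast
  finally show ?thesis .
qed

lemma lex_sum_induced:
  assumes "FLD1_decomp I X" "i \<in> dom_of I"
  shows "X i = (dom_of (X i), le_of (lex_sum I X) \<inter> dom_of (X i) \<times> dom_of (X i))"
proof -
  have dj: "j = i" if "j \<in> dom_of I" "x \<in> dom_of (X j)" "x \<in> dom_of (X i)" for j x
    using assms that unfolding FLD1_decomp_def disjoint_family_on_def by blast
  have "le_of (X i) \<subseteq> dom_of (X i) \<times> dom_of (X i)"
    using assms unfolding FLD1_decomp_def is_po_def partial_order_on_def preorder_on_def by blast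
  then have "le_of (X i) = le_of (lex_sum I X) \<inter> dom_of (X i) \<times> dom_of (X i)"
    using assms(2) dj unfolding lex_sum_def snd_conv by blast
  then show ?thesis by (metis prod.collapse)
qed

lemma is_po_image:
  assumes "is_po X" "inj_on f (dom_of X)"
  shows "is_po (image_struct f X)"
proof -
  have X: "le_of X \<subseteq> dom_of X \<times> dom_of X" "\<forall>x\<in>dom_of X. (x, x) \<in> le_of X"
    "trans (le_of X)" "antisym (le_of X)"
    using assms(1) unfolding is_po_def partial_order_on_def preorder_on_def refl_on_def by auto
  note le = image_struct_le[OF assms(2) X(1)]
  have sub: "map_prod f f ` le_of X \<subseteq> f ` dom_of X \<times> f ` dom_of X" using X(1) by auto
  have "trans (map_prod f f ` le_of X)"
  proof (rule transI)
    fix x y z assume xy: "(x, y) \<in> map_prod f f ` le_of X" and yz: "(y, z) \<in> map_prod f f ` le_of X"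
    then obtain a b c where "x = f a" "y = f b" "z = f c" "a \<in> dom_of X" "b \<in> dom_of X" "c \<in> dom_of X"
      using subsetD[OF sub xy] subsetD[OF sub yz] by auto
    then show "(x, z) \<in> map_prod f f ` le_of X" using xy yz X(3) le by (auto dest: transD)
  qed
  moreover have "antisym (map_prod f f ` le_of X)"
  proof (rule antisymI)
    fix x y assume xy: "(x, y) \<in> map_prod f f ` le_of X" and yx: "(y, x) \<in> map_prod f f ` le_of X"
    then obtain a b where "x = f a" "y = f b" "a \<in> dom_of X" "b \<in> dom_of X"
      using subsetD[OF sub xy] by auto
    then show "x = y" using xy yx X(4) le by (auto dest: antisymD)
  qed
  ultimately show ?thesis
    using sub X(2) unfolding is_po_def partial_order_on_def preorder_on_def refl_on_def image_struct_def
    by auto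
qed

lemma FLD1_decomp_reindex:
  assumes d: "FLD1_decomp I X" and h: "inj_on h (dom_of I)"
  shows "FLD1_decomp (image_struct h I) (X \<circ> inv_into (dom_of I) h)"
    and "lex_sum (image_struct h I) (X \<circ> inv_into (dom_of I) h) = lex_sum I X"
proof -
  have I: "le_of I \<subseteq> dom_of I \<times> dom_of I" "is_po I"
    using d unfolding FLD1_decomp_def is_po_def partial_order_on_def preorder_on_def by auto
  show "FLD1_decomp (image_struct h I) (X \<circ> inv_into (dom_of I) h)"
    using d is_po_image[OF I(2) h] h
    unfolding FLD1_decomp_def disjoint_family_on_def
    by (auto simp: image_struct_def inv_into_f_f inj_on_eq_iff)
  show "lex_sum (image_struct h I) (X \<circ> inv_into (dom_of I) h) = lex_sum I X"
    using h by (simp add: lex_sum_def image_struct_def inv_into_f_f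
      image_struct_le[OF h I(1)] inj_on_eq_iff cong: bex_cong)
qed

lemma FLD1_I:
  fixes I :: "'i struct"
  assumes "FLD1_decomp I X"
  shows "FLD1 (lex_sum I X)"
proof -
  have "countable (dom_of I)" using assms by (simp add: FLD1_decomp_def countable_finite)
  then show ?thesis
    using FLD1_decomp_reindex[OF assms inj_on_to_nat_on] unfolding FLD1_def by metis
qed

lemma FLD1_decomp_image:
  fixes I :: "'i struct"
  assumes d: "FLD1_decomp I X" and f: "inj_on f (dom_of (lex_sum I X))"
  shows "FLD1_decomp I (\<lambda>i. image_struct f (X i))"
    and "lex_sum I (\<lambda>i. image_struct f (X i)) = image_struct f (lex_sum I X)"
proof -
  have fi: "inj_on f (dom_of (X i))" if "i \<in> dom_of I" for i
    by (rule inj_on_subset[OF f]) (use that in \<open>auto simp: lex_sum_def\<close>)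
  have sub: "le_of (X i) \<subseteq> dom_of (X i) \<times> dom_of (X i)" if "i \<in> dom_of I" for i
    using d that unfolding FLD1_decomp_def is_po_def partial_order_on_def preorder_on_def by blast
  have "has_largest (image_struct f (X i))" if "has_largest (X i)" for i
    using that by (force simp: has_largest_def image_struct_def)
  moreover have "disjoint_family_on (\<lambda>i. dom_of (image_struct f (X i))) (dom_of I)"
    unfolding disjoint_family_on_def
  proof (intro ballI impI)
    fix i j assume ij: "i \<in> dom_of I" "j \<in> dom_of I" "i \<noteq> j"
    have "f ` dom_of (X i) \<inter> f ` dom_of (X j) = f ` (dom_of (X i) \<inter> dom_of (X j))"
      by (rule inj_on_image_Int[OF f, symmetric]) (use ij in \<open>auto simp: lex_sum_def\<close>)
    also have "\<dots> = {}" using d ij by (auto simp: FLD1_decomp_def disjoint_family_on_def)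
    finally show "dom_of (image_struct f (X i)) \<inter> dom_of (image_struct f (X j)) = {}"
      by (simp add: image_struct_def)
  qed
  ultimately show "FLD1_decomp I (\<lambda>i. image_struct f (X i))"
    using d fi is_po_image unfolding FLD1_decomp_def by blast
  have lex: "le_of (lex_sum I Z) = (\<Union>i\<in>dom_of I. le_of (Z i)) \<union>
      (\<Union>(i, j)\<in>{p \<in> dom_of I \<times> dom_of I. fst p \<noteq> snd p \<and> p \<in> le_of I}. dom_of (Z i) \<times> dom_of (Z j))"
    if "\<And>i. i \<in> dom_of I \<Longrightarrow> le_of (Z i) \<subseteq> dom_of (Z i) \<times> dom_of (Z i)" for Z :: "'i \<Rightarrow> 'c struct"
    unfolding lex_sum_def using that by auto blast
  have sub': "le_of (image_struct f (X i)) \<subseteq> dom_of (image_struct f (X i)) \<times> dom_of (image_struct f (X i))"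
    if "i \<in> dom_of I" for i
    using sub[OF that] by (auto simp: image_struct_def)
  have "le_of (lex_sum I (\<lambda>i. image_struct f (X i))) = map_prod f f ` le_of (lex_sum I X)"
    using lex[of "\<lambda>i. image_struct f (X i)"] lex[of X] sub sub'
    by (simp add: image_struct_def case_prod_unfold image_Un image_UN map_prod_surj_on[OF refl refl])
  then show "lex_sum I (\<lambda>i. image_struct f (X i)) = image_struct f (lex_sum I X)"
    by (auto simp: lex_sum_def image_struct_def image_UN)
qed

lemma FLD1_decomp_restr:
  assumes d: "FLD1_decomp I X"
    and m: "\<And>i. i \<in> dom_of I \<Longrightarrow> m i \<in> dom_of (X i) \<inter> B \<and> (\<forall>x\<in>dom_of (X i). (x, m i) \<in> le_of (X i))"
  shows "FLD1_decomp I (\<lambda>i. restr_struct (X i) B)"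
    and "lex_sum I (\<lambda>i. restr_struct (X i) B) = restr_struct (lex_sum I X) B"
proof -
  have "is_po (restr_struct (X i) B)" if "is_po (X i)" for i
    using that unfolding is_po_def partial_order_on_def preorder_on_def refl_on_def restr_struct_def
      antisym_def trans_def by auto
  moreover have "has_largest (restr_struct (X i) B)" if "i \<in> dom_of I" for i
    using m[OF that] by (auto simp: has_largest_def restr_struct_def)
  ultimately show "FLD1_decomp I (\<lambda>i. restr_struct (X i) B)"
    using d unfolding FLD1_decomp_def disjoint_family_on_def by (auto simp: restr_struct_def) blast
  show "lex_sum I (\<lambda>i. restr_struct (X i) B) = restr_struct (lex_sum I X) B"
    by (auto simp: lex_sum_def restr_struct_def)
qed

lemma FLD1_theoryI:
  fixes I :: "'i struct" and X :: "'i \<Rightarrow> 'a struct"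
  assumes T: "complete_theory T" "\<forall>\<phi>\<in>po_axioms. entails T \<phi>"
    and dec: "(I, X) \<in> FLD1_decomps T"
  shows "FLD1_theory T"
proof -
  let ?S = "lex_sum I X"
  have d: "FLD1_decomp I X" and M: "is_model ?S T" using dec by (auto simp: FLD1_decomps_def)
  have str: "is_struct ?S" using M by (simp add: is_model_def)
  have "\<forall>i\<in>dom_of I. \<exists>m\<in>dom_of (X i). \<forall>x\<in>dom_of (X i). (x, m) \<in> le_of (X i)"
    using d by (auto simp: FLD1_decomp_def has_largest_def)
  then obtain m where
    m: "\<And>i. i \<in> dom_of I \<Longrightarrow> m i \<in> dom_of (X i) \<and> (\<forall>x\<in>dom_of (X i). (x, m i) \<in> le_of (X i))"
    by metis
  have "countable (m ` dom_of I)" using d by (simp add: FLD1_decomp_def countable_finite)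
  moreover have "m ` dom_of I \<subseteq> dom_of ?S" using m by (auto simp: lex_sum_def)
  ultimately obtain B where B: "countable B" "m ` dom_of I \<subseteq> B" "B \<subseteq> dom_of ?S" "B \<noteq> {}"
    and el: "\<And>e \<phi>. range e \<subseteq> B \<Longrightarrow> sat (B, le_of ?S \<inter> B \<times> B) e \<phi> \<longleftrightarrow> sat ?S e \<phi>"
    using loewenheim_skolem[OF str] by metis
  let ?Z = "restr_struct ?S B"
  have Zeq: "?Z = (B, le_of ?S \<inter> B \<times> B)" using B(3) by (auto simp: restr_struct_def)
  have Z: "is_struct ?Z" using B(4) by (auto simp: Zeq is_struct_def)
  have "\<And>i. i \<in> dom_of I \<Longrightarrow> m i \<in> dom_of (X i) \<inter> B \<and> (\<forall>x\<in>dom_of (X i). (x, m i) \<in> le_of (X i))"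
    using m B(2) by auto
  note r = FLD1_decomp_restr[OF d this]
  have cZ: "countable (dom_of ?Z)" using B(1) by (simp add: Zeq)
  let ?f = "to_nat_on (dom_of ?Z)"
  let ?Y = "image_struct ?f ?Z"
  have inj: "inj_on ?f (dom_of ?Z)" using cZ by (rule inj_on_to_nat_on)
  have iso: "is_iso ?Z ?Y ?f" using image_struct_iso[OF inj Z] .
  have "FLD1 ?Y"
    using FLD1_I[OF FLD1_decomp_image(1)[OF r(1), of ?f]] FLD1_decomp_image(2)[OF r(1), of ?f] inj
    by (simp add: r(2))
  moreover have "is_model ?Y T"
  proof -
    obtain b where b: "b \<in> B" using B(4) by auto
    have "holds ?Z \<phi>" if "\<phi> \<in> T" for \<phi>
    proof -
      have s: "\<phi> \<in> sentences" using that T(1) by (auto simp: complete_theory_def)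
      have "holds ?S \<phi>" using that M by (simp add: is_model_def)
      then show ?thesis
        using el[of "\<lambda>_. b" \<phi>] holds_sentence[OF s, of "\<lambda>_. b" ?S]
          holds_sentence[OF s, of "\<lambda>_. b" ?Z] b B(3) by (auto simp: Zeq)
    qed
    then show ?thesis
      using holds_iso[OF iso _ Z] image_struct_is_struct[OF Z] T(1)
      unfolding is_model_def complete_theory_def by blast
  qed
  ultimately show ?thesis using T unfolding FLD1_theory_def by blast
qed

text \<open>A finite structure is determined up to isomorphism by its theory.\<close>

primrec Conjs :: "fm list \<Rightarrow> fm" where
  "Conjs [] = All 0 (Eq 0 0)"
| "Conjs (\<phi> # \<phi>s) = Conj \<phi> (Conjs \<phi>s)"

primrec Exs :: "nat \<Rightarrow> fm \<Rightarrow> fm" where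
  "Exs 0 \<phi> = \<phi>"
| "Exs (Suc n) \<phi> = Exs n (Ex n \<phi>)"

lemma sat_Conjs: "sat X e (Conjs \<phi>s) \<longleftrightarrow> (\<forall>\<phi>\<in>set \<phi>s. sat X e \<phi>)"
  by (induction \<phi>s) auto

lemma fv_Conjs: "fv (Conjs \<phi>s) = (\<Union>\<phi>\<in>set \<phi>s. fv \<phi>)"
  by (induction \<phi>s) auto

lemma fv_Exs: "fv (Exs n \<phi>) = fv \<phi> - {..<n}"
  by (induction n arbitrary: \<phi>) auto

lemma sat_Exs:
  "sat X e (Exs n \<phi>) \<longleftrightarrow> (\<exists>e'. (\<forall>i<n. e' i \<in> dom_of X) \<and> (\<forall>i\<ge>n. e' i = e i) \<and> sat X e' \<phi>)"
proof (induction n arbitrary: \<phi>)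
  case 0
  have "e' = e" if "\<forall>i. e' i = e i" for e' using that by auto
  then show ?case by auto
next
  case (Suc n)
  show ?case
  proof
    assume "sat X e (Exs (Suc n) \<phi>)"
    then obtain e' a where "\<forall>i<n. e' i \<in> dom_of X" "\<forall>i\<ge>n. e' i = e i" "a \<in> dom_of X"
      "sat X (e'(n := a)) \<phi>" using Suc by auto
    then show "\<exists>e'. (\<forall>i<Suc n. e' i \<in> dom_of X) \<and> (\<forall>i\<ge>Suc n. e' i = e i) \<and> sat X e' \<phi>"
      by (intro exI[of _ "e'(n := a)"]) (auto simp: less_Suc_eq)
  next
    assume "\<exists>e'. (\<forall>i<Suc n. e' i \<in> dom_of X) \<and> (\<forall>i\<ge>Suc n. e' i = e i) \<and> sat X e' \<phi>"
    then obtain e' where e': "\<forall>i<Suc n. e' i \<in> dom_of X" "\<forall>i\<ge>Suc n. e' i = e i" "sat X e' \<phi>"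
      by blast
    let ?e = "e'(n := e n)"
    have "sat X ?e (Ex n \<phi>)" using e' by (auto intro!: bexI[of _ "e' n"])
    moreover have "\<forall>i<n. ?e i \<in> dom_of X" "\<forall>i\<ge>n. ?e i = e i" using e' by auto
    ultimately show "sat X e (Exs (Suc n) \<phi>)" unfolding Exs.simps Suc by blast
  qed
qed

lemma finite_struct_categorical:
  fixes X :: "'a struct" and Y :: "'b struct"
  assumes fin: "finite (dom_of X)" and X: "is_struct X" and Y: "is_model Y (Th X)"
  shows "X \<cong>\<^sub>s Y"
proof -
  obtain n :: nat and g where g: "bij_betw g {..<n} (dom_of X)"
    using ex_bij_betw_nat_finite[OF fin] by (metis atLeast0LessThan)
  define \<psi> where "\<psi> = Conj (All n (Neg (Conjs (map (\<lambda>i. Neg (Eq n i)) [0..<n]))))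
     (Conjs (map (\<lambda>(i, j). Conj (if i = j then Eq i j else Neg (Eq i j))
        (if (g i, g j) \<in> le_of X then Leq i j else Neg (Leq i j))) (List.product [0..<n] [0..<n])))"
  have sat_psi: "sat Z e \<psi> \<longleftrightarrow> (\<forall>z\<in>dom_of Z. \<exists>i<n. z = e i) \<and>
     (\<forall>i<n. \<forall>j<n. (i = j \<longleftrightarrow> e i = e j) \<and> ((g i, g j) \<in> le_of X \<longleftrightarrow> (e i, e j) \<in> le_of Z))"
    for Z :: "'c struct" and e
  proof -
    have "sat Z e \<psi> \<longleftrightarrow> (\<forall>z\<in>dom_of Z. \<exists>i\<in>{..<n}. z = e i) \<and>
      (\<forall>i\<in>{..<n}. \<forall>j\<in>{..<n}. (i = j \<longleftrightarrow> e i = e j) \<and> ((g i, g j) \<in> le_of X \<longleftrightarrow> (e i, e j) \<in> le_of Z))"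
      unfolding \<psi>_def by (auto simp: sat_Conjs atLeast0LessThan Ball_def Bex_def split: if_splits)
    then show ?thesis by (simp add: Ball_def Bex_def)
  qed
  have sent: "Exs n \<psi> \<in> sentences"
    by (auto simp: sentences_def fv_Exs fv_Conjs \<psi>_def split: if_splits)
  have nonempty: "dom_of X \<noteq> {}" "dom_of Y \<noteq> {}" using X Y by (auto simp: is_struct_def is_model_def)
  have "holds X (Exs n \<psi>)"
    unfolding holds_def sat_Exs
  proof (intro allI impI)
    fix e :: "nat \<Rightarrow> 'a"
    let ?e = "\<lambda>i. if i < n then g i else e i"
    have "\<forall>z\<in>dom_of X. \<exists>i<n. z = g i" using g by (auto simp: bij_betw_def)
    moreover have "\<forall>i<n. \<forall>j<n. i = j \<longleftrightarrow> g i = g j" using g by (auto simp: bij_betw_def inj_on_def)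
    ultimately have "sat X ?e \<psi>" unfolding sat_psi by auto
    moreover have "\<forall>i<n. ?e i \<in> dom_of X" using g by (auto dest: bij_betwE)
    ultimately show "\<exists>e'. (\<forall>i<n. e' i \<in> dom_of X) \<and> (\<forall>i\<ge>n. e' i = e i) \<and> sat X e' \<psi>"
      by (intro exI[of _ ?e]) auto
  qed
  then have "holds Y (Exs n \<psi>)" using Y sent by (auto simp: is_model_def Th_def)
  moreover obtain y where "y \<in> dom_of Y" using nonempty by auto
  ultimately have "sat Y (\<lambda>_. y) (Exs n \<psi>)" by (auto simp: holds_def)
  then obtain e where e: "\<forall>i<n. e i \<in> dom_of Y" and s: "sat Y e \<psi>" unfolding sat_Exs by blast
  have "is_iso ({..<n}, {(i, j). i < n \<and> j < n \<and> (g i, g j) \<in> le_of X}) X g"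
    using g by (auto simp: is_iso_def image_struct_def)
  moreover have "is_iso ({..<n}, {(i, j). i < n \<and> j < n \<and> (g i, g j) \<in> le_of X}) Y e"
    using e s unfolding sat_psi
    by (auto simp: is_iso_def image_struct_def bij_betw_def inj_on_def)
  ultimately show ?thesis using isomorphic_sym isomorphic_trans unfolding isomorphic_def by blast
qed

lemma num_models_of_finite:
  fixes X :: "'a struct"
  assumes "finite (dom_of X)" "is_struct X"
  shows "num_models_of X =o cone"
proof -
  have "is_model X (Th X)" "Th X \<subseteq> sentences" using assms(2) by (auto simp: is_model_def Th_def)
  then obtain Y :: "nat struct" where Y: "is_model Y (Th X)" using model_nat by blast
  have iso: "(Y, Z) \<in> iso_rel" if "is_model Z (Th X)" for Z :: "nat struct"
    using finite_struct_categorical[OF assms Y] finite_struct_categorical[OF assms that]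
      isomorphic_sym isomorphic_trans unfolding iso_rel_def by blast
  have "iso_rel `` {Z} = iso_rel `` {Y}" if "is_model Z (Th X)" for Z
    using equiv_class_eq[OF equiv_iso_rel iso[OF that]] ..
  then have "{Z :: nat struct. is_model Z (Th X)} // iso_rel = {iso_rel `` {Y}}"
    using Y unfolding quotient_def by blast
  then show ?thesis
    unfolding num_models_of_def num_models_def BNF_Cardinal_Arithmetic.cone_def
    by (auto intro!: card_of_ordIsoI[of "\<lambda>_. ()"] simp: bij_betw_def)
qed

end

theory Submission
  imports Defs "HOL-Analysis.Function_Metric" "HOL-Analysis.Topology_Euclidean_Space"
begin

text \<open>
  A summand of a finite sum is recovered from the largest elements \<open>m\<^sub>j\<close> of all summands: \<open>x\<close> lies in
  the \<open>i\<close>-th one iff \<open>i\<close> is the least index with \<open>x \<le> m\<^sub>i\<close>. A countable structure therefore has only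
  countably many decompositions over a given finite index order. By the Feferman--Vaught argument,
  replacing the summands by elementarily equivalent ones yields models of the same theory, so this
  maps the product of the sets of isomorphism types countable-to-one into the isomorphism types of
  models of \<open>T\<close>; as the product is uncountable, the inequality follows.

  That the product is \<open>\<omega>\<^sub>1\<close> or the continuum is Morley's theorem, applied to each factor. If there are
  fewer than continuum many countable models, then by induction on \<open>\<alpha> < \<omega>\<^sub>1\<close> there are only countably
  many back-and-forth classes of rank \<open>\<alpha>\<close>: the classes of lower rank being countably many, a class
  of rank \<open>\<alpha>\<close> is coded by a real that depends on the model in a bi-analytic way, and the perfect set
  theorem applies to the set of codes. By Scott's argument a countable structure is determined by
  its class at some countable rank, which leaves at most \<open>\<omega>\<^sub>1\<close> isomorphism types.
\<close>

section \<open>Analytic sets\<close>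

text \<open>The witness space \<open>nat \<Rightarrow> real\<close> stands in for Baire space: it is
  complete and second countable, and countably many witnesses fit into one.\<close>

definition analytic :: "'a::topological_space set \<Rightarrow> bool" where
  "analytic A \<longleftrightarrow> (\<exists>C :: ('a \<times> (nat \<Rightarrow> real)) set. closed C \<and> A = fst ` C)"

lemma closed_vimage_continuous:
  fixes f :: "'a::topological_space \<Rightarrow> 'b::topological_space"
  assumes "closed S" "continuous_on UNIV f"
  shows "closed {x. f x \<in> S}"
  using assms continuous_on_closed_vimage[of UNIV f] by (auto simp: vimage_def)

lemma analytic_closed: "closed A \<Longrightarrow> analytic A"
  unfolding analytic_def by (intro exI[of _ "A \<times> UNIV"]) (auto intro: closed_Times)

lemma analytic_vimage:
  fixes f :: "'a::topological_space \<Rightarrow> 'b::topological_space"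
  assumes "analytic A" "continuous_on UNIV f"
  shows "analytic (f -` A)"
proof -
  obtain C :: "('b \<times> (nat \<Rightarrow> real)) set" where C: "closed C" "A = fst ` C"
    using assms(1) by (auto simp: analytic_def)
  have "continuous_on UNIV (\<lambda>p :: 'a \<times> (nat \<Rightarrow> real). (f (fst p), snd p))"
    by (intro continuous_intros continuous_on_compose2[OF assms(2)]) auto
  from closed_vimage_continuous[OF C(1) this]
  have "closed {p. (f (fst p), snd p) \<in> C}" .
  moreover have "f -` A = fst ` {p. (f (fst p), snd p) \<in> C}" by (auto simp: C(2) image_iff Bex_def)
  ultimately show ?thesis unfolding analytic_def by blast
qed

text \<open>A point of the intersection has a witness for each \<open>n\<close>. Through
  \<open>prod_encode\<close> a single sequence carries all of them, and \<open>g n\<close> reads off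
  the \<open>n\<close>-th.\<close>

lemma analytic_INT:
  fixes A :: "nat \<Rightarrow> 'a::topological_space set"
  assumes "\<And>n. analytic (A n)"
  shows "analytic (\<Inter>n. A n)"
proof -
  obtain C :: "nat \<Rightarrow> ('a \<times> (nat \<Rightarrow> real)) set" where C: "\<And>n. closed (C n)" "\<And>n. A n = fst ` C n"
    using assms unfolding analytic_def by metis
  define g where "g n p = (fst p, \<lambda>m. snd p (prod_encode (n, m)))" for n and p :: "'a \<times> (nat \<Rightarrow> real)"
  have "continuous_on UNIV (g n)" for n
    unfolding g_def
    by (intro continuous_intros continuous_on_coordinatewise_then_product
        continuous_on_product_then_coordinatewise)
  then have cl: "closed (\<Inter>n. {p. g n p \<in> C n})"
    by (intro closed_INT ballI closed_vimage_continuous C) auto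
  have "x \<in> fst ` (\<Inter>n. {p. g n p \<in> C n})" if x: "x \<in> (\<Inter>n. A n)" for x
  proof -
    have "\<forall>n. \<exists>y. (x, y) \<in> C n" using x by (force simp: C(2))
    then obtain y where y: "\<And>n. (x, y n) \<in> C n" by metis
    have "(x, \<lambda>k. y (fst (prod_decode k)) (snd (prod_decode k))) \<in> (\<Inter>n. {p. g n p \<in> C n})"
      using y by (simp add: g_def)
    then show ?thesis by (rule image_eqI[rotated]) simp
  qed
  moreover have "fst p \<in> A n" if "g n p \<in> C n" for n p
    unfolding C(2) using that by (rule image_eqI[rotated]) (simp add: g_def)
  ultimately have "(\<Inter>n. A n) = fst ` (\<Inter>n. {p. g n p \<in> C n})" by blast
  with cl show ?thesis unfolding analytic_def by blast
qed

text \<open>Entry 0 of the new witness stores the index \<open>n\<close> as a real number, and the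
  remaining entries are a witness for \<open>A n\<close>.\<close>

lemma analytic_UN:
  fixes A :: "nat \<Rightarrow> 'a::topological_space set"
  assumes "\<And>n. analytic (A n)"
  shows "analytic (\<Union>n. A n)"
proof -
  obtain C :: "nat \<Rightarrow> ('a \<times> (nat \<Rightarrow> real)) set" where C: "\<And>n. closed (C n)" "\<And>n. A n = fst ` C n"
    using assms unfolding analytic_def by metis
  define g where "g p = (fst p, \<lambda>m. snd p (Suc m))" for p :: "'a \<times> (nat \<Rightarrow> real)"
  \<comment> \<open>That entry 0 being \<open>n\<close> implies \<open>g p \<in> C n\<close> has to
    be a closed condition. As entry 0 is a natural number, differing from \<open>n\<close> means
    being at distance at least 1/2, which is closed.\<close>
  define D where "D = {p. snd p 0 \<in> \<nat>} \<inter> (\<Inter>n. {p. 1/2 \<le> \<bar>snd p 0 - real n\<bar>} \<union> {p. g p \<in> C n})"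
  have D: "p \<in> D \<longleftrightarrow> (\<exists>n. snd p 0 = real n \<and> g p \<in> C n)" for p
  proof
    assume p: "p \<in> D"
    then obtain n where n: "snd p 0 = real n" by (auto simp: D_def elim: Nats_cases)
    moreover have "g p \<in> C n" using p n by (auto simp: D_def dest: spec[of _ n])
    ultimately show "\<exists>n. snd p 0 = real n \<and> g p \<in> C n" by blast
  next
    assume "\<exists>n. snd p 0 = real n \<and> g p \<in> C n"
    then obtain n where n: "snd p 0 = real n" "g p \<in> C n" by blast
    have "1/2 \<le> \<bar>real n - real k\<bar>" if "k \<noteq> n" for k using that by linarith
    then have "p \<in> {p. 1/2 \<le> \<bar>snd p 0 - real k\<bar>} \<union> {p. g p \<in> C k}" for k
      using n by (cases "k = n") auto
    moreover have "snd p 0 \<in> \<nat>" using n by simp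
    ultimately show "p \<in> D" unfolding D_def by blast
  qed
  have g: "continuous_on UNIV g"
    unfolding g_def
    by (intro continuous_intros continuous_on_coordinatewise_then_product
        continuous_on_product_then_coordinatewise)
  have s: "continuous_on UNIV (\<lambda>p :: 'a \<times> (nat \<Rightarrow> real). snd p 0)"
    by (rule continuous_on_product_then_coordinatewise[OF continuous_on_snd[OF continuous_on_id]])
  have "closed {p :: 'a \<times> (nat \<Rightarrow> real). snd p 0 \<in> \<nat>}"
    by (rule closed_vimage_continuous[OF closed_Nats s])
  moreover have "closed {p :: 'a \<times> (nat \<Rightarrow> real). 1/2 \<le> \<bar>snd p 0 - real n\<bar>}" for n
    by (intro closed_Collect_le continuous_on_const continuous_on_rabs continuous_on_diff s)
  moreover have "closed {p. g p \<in> C n}" for n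
    by (rule closed_vimage_continuous[OF C(1) g])
  ultimately have "closed D"
    unfolding D_def by (intro closed_Int closed_INT ballI closed_Un)
  moreover have "(\<Union>n. A n) = fst ` D"
  proof
    show "(\<Union>n. A n) \<subseteq> fst ` D"
    proof
      fix x assume "x \<in> (\<Union>n. A n)"
      then obtain n y where "(x, y) \<in> C n" by (force simp: C(2))
      then have "(x, case_nat (real n) y) \<in> D" by (auto simp: D g_def)
      then show "x \<in> fst ` D" by (rule image_eqI[rotated]) simp
    qed
    show "fst ` D \<subseteq> (\<Union>n. A n)"
    proof
      fix x assume "x \<in> fst ` D"
      then obtain p n where "x = fst p" "g p \<in> C n" by (auto simp: D)
      then have "x \<in> A n" unfolding C(2) by (intro image_eqI[of _ _ "g p"]) (auto simp: g_def)
      then show "x \<in> (\<Union>n. A n)" by blast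
    qed
  qed
  ultimately show ?thesis unfolding analytic_def by blast
qed

lemma analytic_empty: "analytic {}" by (simp add: analytic_closed)
lemma analytic_UNIV: "analytic UNIV" by (simp add: analytic_closed)

lemma analytic_Int: "analytic A \<Longrightarrow> analytic B \<Longrightarrow> analytic (A \<inter> B)"
proof -
  assume "analytic A" "analytic B"
  then have "analytic (\<Inter>n :: nat. if n = 0 then A else B)" by (intro analytic_INT) auto
  also have "(\<Inter>n :: nat. if n = 0 then A else B) = A \<inter> B" by (auto dest: spec[of _ 0] spec[of _ 1])
  finally show ?thesis .
qed

lemma analytic_Un: "analytic A \<Longrightarrow> analytic B \<Longrightarrow> analytic (A \<union> B)"
proof -
  assume "analytic A" "analytic B"
  then have "analytic (\<Union>n :: nat. if n = 0 then A else B)" by (intro analytic_UN) auto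
  also have "(\<Union>n :: nat. if n = 0 then A else B) = A \<union> B" by (auto intro: exI[of _ 0] exI[of _ 1] split: if_splits)
  finally show ?thesis .
qed

section \<open>The perfect set theorem\<close>

text \<open>Size is measured on the values of \<open>g\<close>, because the tree of balls built
  below has to yield different values and not only different points.\<close>

definition big :: "('a \<Rightarrow> 'b) \<Rightarrow> 'a set \<Rightarrow> 'a set \<Rightarrow> bool" where
  "big g P U \<longleftrightarrow> uncountable (g ` (P \<inter> U))"

text \<open>By Lindelof, the points of \<open>P\<close> in the ball that have a small neighbourhood
  contribute only countably many values. So \<open>K\<close>, the points whose balls are all big,
  contains two points with different values; Hausdorff separation and continuity turn them into two
  small balls with disjoint images.\<close>

lemma big_split:
  fixes P :: "'a::{metric_space, second_countable_topology} set" and g :: "'a \<Rightarrow> 'b::t2_space"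
  assumes cont: "continuous_on UNIV g" and big: "big g P (ball c r)" and "e > 0"
  obtains a s b t where "a \<in> P" "b \<in> P" "0 < s" "s < e" "0 < t" "t < e"
    "cball a s \<subseteq> ball c r" "cball b t \<subseteq> ball c r"
    "big g P (ball a s)" "big g P (ball b t)" "g ` cball a s \<inter> g ` cball b t = {}"
proof -
  define K where "K = {a \<in> P \<inter> ball c r. \<forall>d>0. big g P (ball a d)}"
  define \<U> where "\<U> = {ball a d | a d. \<not> big g P (ball a d)}"
  obtain \<V> where V: "\<V> \<subseteq> \<U>" "countable \<V>" "\<Union>\<V> = \<Union>\<U>"
    using Lindelof[of \<U>] by (auto simp: \<U>_def)
  have "P \<inter> ball c r - K \<subseteq> (\<Union>U\<in>\<V>. P \<inter> U)"
  proof
    fix a assume a: "a \<in> P \<inter> ball c r - K"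
    then obtain d where "d > 0" "\<not> big g P (ball a d)" by (auto simp: K_def)
    then have "ball a d \<in> \<U>" "a \<in> ball a d" by (auto simp: \<U>_def)
    then have "a \<in> \<Union>\<U>" by blast
    then show "a \<in> (\<Union>U\<in>\<V>. P \<inter> U)" using V(3) a by blast
  qed
  then have "g ` (P \<inter> ball c r - K) \<subseteq> (\<Union>U\<in>\<V>. g ` (P \<inter> U))" by blast
  moreover have "countable (\<Union>U\<in>\<V>. g ` (P \<inter> U))"
    using V(1) by (intro countable_UN V(2)) (auto simp: \<U>_def big_def)
  ultimately have "countable (g ` (P \<inter> ball c r - K))" by (rule countable_subset)
  moreover have "g ` (P \<inter> ball c r) = g ` (P \<inter> ball c r - K) \<union> g ` K" by (auto simp: K_def)
  ultimately have unc: "uncountable (g ` K)" using big by (simp add: big_def)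
  have "\<exists>a\<in>K. \<exists>b\<in>K. g a \<noteq> g b"
  proof (rule ccontr)
    assume "\<not> ?thesis"
    then have "\<exists>v. g ` K \<subseteq> {v}" by blast
    then show False using unc by (metis countable_empty countable_insert countable_subset)
  qed
  then obtain a b where ab: "a \<in> K" "b \<in> K" "g a \<noteq> g b" by blast
  obtain A B where AB: "open A" "open B" "g a \<in> A" "g b \<in> B" "A \<inter> B = {}"
    using hausdorff[OF ab(3)] by blast
  have small: "\<exists>s. 0 < s \<and> s < e \<and> cball x s \<subseteq> ball c r \<and> g ` cball x s \<subseteq> W"
    if "x \<in> K" "open W" "g x \<in> W" for x W
  proof -
    have "open (g -` W \<inter> ball c r)"
      using continuous_open_vimage[OF that(2), of g] cont
      by (auto simp: continuous_on_eq_continuous_at intro!: open_Int)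
    moreover have "x \<in> g -` W \<inter> ball c r" using that by (auto simp: K_def)
    ultimately obtain d where d: "d > 0" "cball x d \<subseteq> g -` W \<inter> ball c r"
      by (meson open_contains_cball)
    have "cball x (min d (e/2)) \<subseteq> cball x d" by auto
    then show ?thesis using d \<open>e > 0\<close> by (intro exI[of _ "min d (e/2)"]) auto
  qed
  obtain s where s: "0 < s" "s < e" "cball a s \<subseteq> ball c r" "g ` cball a s \<subseteq> A"
    using small[OF ab(1) AB(1,3)] by blast
  obtain t where t: "0 < t" "t < e" "cball b t \<subseteq> ball c r" "g ` cball b t \<subseteq> B"
    using small[OF ab(2) AB(2,4)] by blast
  have disj: "g ` cball a s \<inter> g ` cball b t = {}" using s(4) t(4) AB(5) by blast
  show thesis
    by (rule that[of a b s t]) (use ab(1,2) s(1-3) t(1-3) disj in \<open>auto simp: K_def\<close>)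
qed

text \<open>A Cantor scheme: \<open>big_split\<close> is iterated along a binary tree of balls whose
  radii tend to 0. By completeness each branch converges to a point of \<open>P\<close>, and
  different branches give different values of \<open>g\<close>.\<close>

theorem perfect_set_image:
  fixes P :: "'a::{complete_space, second_countable_topology} set" and g :: "'a \<Rightarrow> 'b::t2_space"
  assumes P: "closed P" and cont: "continuous_on UNIV g" and unc: "uncountable (g ` P)"
  shows "|UNIV :: (nat \<Rightarrow> bool) set| \<le>o |g ` P|"
proof -
  have "\<exists>c r. big g P (ball c r) \<and> c \<in> P \<and> 0 < r"
  proof -
    obtain c where c: "c \<in> P" using unc by fastforce
    have "P = (\<Union>n. P \<inter> ball c (real n))"
      using reals_Archimedean2[of "dist c _"] by (auto simp: dist_commute)
    then have "g ` P = (\<Union>n. g ` (P \<inter> ball c (real n)))" by blast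
    then have "\<exists>n. uncountable (g ` (P \<inter> ball c (real n)))" using unc by (metis countableI_type countable_UN)
    then obtain n where n: "uncountable (g ` (P \<inter> ball c (real n)))" by blast
    then have "0 < real n" by (cases n) auto
    then show ?thesis using n c unfolding big_def by blast
  qed
  then obtain c0 r0 where c0: "big g P (ball c0 r0)" "c0 \<in> P" "0 < r0" by blast
  define good where "good p \<longleftrightarrow> fst p \<in> P \<and> 0 < snd p \<and> big g P (ball (fst p) (snd p))" for p :: "'a \<times> real"
  \<comment> \<open>\<open>q True\<close> and \<open>q False\<close> are the two children of the
    ball \<open>p\<close>. Indexing them by \<open>bool\<close> lets the next entry of a branch
    select the child.\<close>
  define sep where "sep p e q \<longleftrightarrow> (\<forall>b. good (q b) \<and> snd (q b) < e \<and>
      cball (fst (q b)) (snd (q b)) \<subseteq> ball (fst p) (snd p) \<and>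
      g ` cball (fst (q b)) (snd (q b)) \<inter> g ` cball (fst (q (\<not> b))) (snd (q (\<not> b))) = {})"
    for p :: "'a \<times> real" and e and q :: "bool \<Rightarrow> 'a \<times> real"
  define q where "q p e = (SOME q. sep p e q)" for p e
  have "sep p e (q p e)" if pe: "good p" "e > 0" for p e
  proof -
    obtain a s b t where ab: "a \<in> P" "b \<in> P" "0 < s" "s < e" "0 < t" "t < e"
      "cball a s \<subseteq> ball (fst p) (snd p)" "cball b t \<subseteq> ball (fst p) (snd p)"
      "big g P (ball a s)" "big g P (ball b t)" "g ` cball a s \<inter> g ` cball b t = {}"
      using big_split[OF cont, of P "fst p" "snd p" e] pe unfolding good_def by metis
    have "sep p e (\<lambda>x. if x then (a, s) else (b, t))"
      using ab by (simp add: sep_def good_def Int_commute)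
    then show ?thesis unfolding q_def by (rule someI[of "sep p e"])
  qed
  then have q: "good (q p e b)" "snd (q p e b) < e"
    "cball (fst (q p e b)) (snd (q p e b)) \<subseteq> ball (fst p) (snd p)"
    "g ` cball (fst (q p e b)) (snd (q p e b)) \<inter> g ` cball (fst (q p e (\<not> b))) (snd (q p e (\<not> b))) = {}"
    if "good p" "e > 0" for p e b
    using that unfolding sep_def by blast+
  \<comment> \<open>\<open>S x n\<close> holds centre and radius of the node at depth
    \<open>n\<close> on the branch \<open>x\<close>. The bound on the radius of the next node makes
    the centres a Cauchy sequence.\<close>
  define S where "S x = rec_nat (c0, r0) (\<lambda>n p. q p (inverse (real (Suc n))) (x n))" for x :: "nat \<Rightarrow> bool"
  have S0: "S x 0 = (c0, r0)" and SS: "S x (Suc n) = q (S x n) (inverse (real (Suc n))) (x n)" for x n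
    by (simp_all add: S_def)
  have good: "good (S x n)" for x n
    by (induction n) (use c0 q(1) in \<open>auto simp: S0 SS good_def\<close>)
  let ?B = "\<lambda>x n. cball (fst (S x n)) (snd (S x n))"
  have rad: "snd (S x (Suc n)) < inverse (real (Suc n))" for x n
    using q(2)[OF good[of x n], of "inverse (real (Suc n))" "x n"] by (simp add: SS)
  have nest1: "?B x (Suc n) \<subseteq> ?B x n" for x n
    using q(3)[OF good[of x n], of "inverse (real (Suc n))" "x n"] ball_subset_cball[of "fst (S x n)" "snd (S x n)"]
    by (auto simp: SS)
  have nest: "?B x m \<subseteq> ?B x n" if "n \<le> m" for x n m
    using that
  proof (induction rule: dec_induct)
    case (step k)
    then show ?case using order_trans[OF nest1[of x k]] by blast
  qed simp
  have ctr: "fst (S x m) \<in> ?B x n" if "n \<le> m" for x n m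
  proof -
    have "fst (S x m) \<in> ?B x m" using good[of x m] by (simp add: good_def)
    then show ?thesis using nest[OF that, of x] by (rule rev_subsetD)
  qed
  have "\<exists>y. y \<in> P \<and> (\<forall>n. y \<in> ?B x n)" for x
  proof -
    have "Cauchy (\<lambda>n. fst (S x n))"
    proof (rule metric_CauchyI)
      fix e :: real assume "0 < e"
      then obtain k where k: "inverse (real (Suc k)) < e / 2" using reals_Archimedean[of "e/2"] by auto
      have "dist (fst (S x m)) (fst (S x n)) < e" if "Suc k \<le> m" "Suc k \<le> n" for m n
      proof -
        have "dist (fst (S x (Suc k))) (fst (S x m)) < e / 2" "dist (fst (S x (Suc k))) (fst (S x n)) < e / 2"
          using ctr[OF that(1), of x] ctr[OF that(2), of x] rad[of x k] k by auto
        then show ?thesis by (metis dist_commute dist_triangle_half_r)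
      qed
      then show "\<exists>M. \<forall>m\<ge>M. \<forall>n\<ge>M. dist (fst (S x m)) (fst (S x n)) < e" by blast
    qed
    then obtain y where y: "(\<lambda>n. fst (S x n)) \<longlonglongrightarrow> y" using Cauchy_convergent convergent_def by blast
    have "y \<in> P" using closed_sequentially[OF P _ y] good by (auto simp: good_def)
    moreover have "y \<in> ?B x n" for n
    proof (rule closed_sequentially[OF closed_cball])
      show "(\<lambda>m. fst (S x (m + n))) \<longlonglongrightarrow> y" using y by (rule LIMSEQ_ignore_initial_segment)
      show "fst (S x (m + n)) \<in> ?B x n" for m by (rule ctr) simp
    qed
    ultimately show ?thesis by blast
  qed
  then obtain Y where Y: "\<And>x. Y x \<in> P" "\<And>x n. Y x \<in> ?B x n" by metis
  have "inj (\<lambda>x. g (Y x))"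
  proof (rule injI, rule ccontr)
    fix x x' assume eq: "g (Y x) = g (Y x')" and "x \<noteq> x'"
    then have ex: "\<exists>n. x n \<noteq> x' n" by auto
    \<comment> \<open>At their first difference both branches are still at the same node and take
      its two different children, whose images are disjoint.\<close>
    define n where "n = (LEAST n. x n \<noteq> x' n)"
    have n: "x n \<noteq> x' n" using ex unfolding n_def by (rule LeastI_ex)
    have less: "x k = x' k" if "k < n" for k using that not_less_Least unfolding n_def by blast
    have "S x k = S x' k" if "k \<le> n" for k
      using that by (induction k) (auto simp: S0 SS less)
    then have Sn: "S x n = S x' n" by simp
    have "S x' (Suc n) = q (S x n) (inverse (real (Suc n))) (\<not> x n)" using n by (cases "x n") (auto simp: SS Sn)
    then have "g ` ?B x (Suc n) \<inter> g ` ?B x' (Suc n) = {}"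
      using q(4)[OF good[of x n], of "inverse (real (Suc n))" "x n"] by (simp add: SS)
    then show False using Y(2)[of x "Suc n"] Y(2)[of x' "Suc n"] eq by blast
  qed
  moreover have "range (\<lambda>x. g (Y x)) \<subseteq> g ` P" using Y(1) by blast
  ultimately show ?thesis using card_of_ordLeq by blast
qed

text \<open>The map sending \<open>x\<close> to \<open>\<lambda>n. x \<in> S n\<close> need not be
  continuous, but its graph over \<open>A\<close> is analytic, because every \<open>S n\<close> and
  its complement are. So the graph is the projection of a closed set \<open>C\<close>, from which
  the values are read off continuously, and the perfect set theorem applies to
  \<open>C\<close>.\<close>

lemma analytic_image_dichotomy:
  fixes A :: "'a::{complete_space, second_countable_topology} set" and S :: "nat \<Rightarrow> 'a set"
  assumes A: "analytic A" and S: "\<And>n. analytic (S n)" "\<And>n. analytic (- S n)"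
  shows "countable ((\<lambda>x n. x \<in> S n) ` A) \<or> |UNIV :: (nat \<Rightarrow> bool) set| \<le>o |(\<lambda>x n. x \<in> S n) ` A|"
proof -
  define f where "f x = (\<lambda>n :: nat. x \<in> S n)" for x
  \<comment> \<open>Truth values become the reals 1 and 0, so that the graph lives in a complete
    second countable space.\<close>
  define h where "h v = (\<lambda>n :: nat. if v n then 1 else 0 :: real)" for v
  define G where "G = fst -` A \<inter> (\<Inter>n. (fst -` S n \<inter> {p. snd p n = (1::real)}) \<union> (fst -` (- S n) \<inter> {p. snd p n = 0}))"
  have coord: "continuous_on UNIV (\<lambda>p :: 'a \<times> (nat \<Rightarrow> real). snd p n)" for n
    by (rule continuous_on_product_then_coordinatewise[OF continuous_on_snd[OF continuous_on_id]])
  have "analytic {p :: 'a \<times> (nat \<Rightarrow> real). snd p n = c}" for n c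
    using closed_vimage_continuous[OF closed_singleton coord] by (intro analytic_closed) simp
  moreover have "analytic (fst -` B :: ('a \<times> (nat \<Rightarrow> real)) set)" if "analytic B" for B :: "'a set"
    using that by (rule analytic_vimage) (intro continuous_intros)
  ultimately have "analytic G"
    unfolding G_def by (intro analytic_Int analytic_Un analytic_INT) (simp_all only: A S)
  then obtain C :: "(('a \<times> (nat \<Rightarrow> real)) \<times> (nat \<Rightarrow> real)) set" where C: "closed C" "G = fst ` C"
    by (auto simp: analytic_def)
  have G: "p \<in> G \<longleftrightarrow> fst p \<in> A \<and> snd p = h (f (fst p))" for p
  proof -
    have "p \<in> G \<longleftrightarrow> fst p \<in> A \<and> (\<forall>n. fst p \<in> S n \<and> snd p n = 1 \<or> fst p \<notin> S n \<and> snd p n = 0)"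
      unfolding G_def by simp
    also have "\<dots> \<longleftrightarrow> fst p \<in> A \<and> (\<forall>n. snd p n = h (f (fst p)) n)"
      by (rule arg_cong2[where f = "(\<and>)", OF refl], rule all_cong1) (simp add: f_def h_def)
    finally show ?thesis by (simp add: fun_eq_iff)
  qed
  have "snd ` G = h ` f ` A"
  proof
    show "snd ` G \<subseteq> h ` f ` A" by (auto simp: G)
    show "h ` f ` A \<subseteq> snd ` G"
    proof
      fix z assume "z \<in> h ` f ` A"
      then obtain x where "x \<in> A" "z = h (f x)" by blast
      then have "(x, z) \<in> G" by (simp add: G)
      then show "z \<in> snd ` G" by (rule image_eqI[rotated]) simp
    qed
  qed
  then have im: "(\<lambda>p. snd (fst p)) ` C = h ` f ` A" by (simp add: C(2) image_image)
  have inj: "inj h" by (rule injI) (auto simp: h_def fun_eq_iff split: if_splits)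
  have "continuous_on UNIV (\<lambda>p :: ('a \<times> (nat \<Rightarrow> real)) \<times> (nat \<Rightarrow> real). snd (fst p))"
    by (intro continuous_intros)
  note perfect = perfect_set_image[OF C(1) this, unfolded im]
  have "countable (f ` A)" if "countable (h ` f ` A)"
    using that inj by (metis countable_image_inj_on inj_on_subset subset_UNIV)
  moreover have "|h ` f ` A| \<le>o |f ` A|" by (rule card_of_image)
  ultimately show ?thesis using perfect ordLeq_transitive unfolding f_def by blast
qed

section \<open>Tame classes of structures\<close>

text \<open>An entry equal to 0 means membership. Real-valued codes form a space to which the
  perfect set theorem applies; a structure has many of them.\<close>

definition decode :: "(nat \<Rightarrow> real) \<times> (nat \<times> nat \<Rightarrow> real) \<Rightarrow> nat struct" where
  "decode p = ({n. fst p n = 0}, {m. snd p m = 0})"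

lemma surj_decode: "surj decode"
proof (rule surjI)
  show "decode (\<lambda>n. if n \<in> dom_of M then 0 else 1, \<lambda>m. if m \<in> le_of M then 0 else 1) = M" for M
    by (auto simp: decode_def prod_eq_iff)
qed

text \<open>Bi-analytic classes replace Borel ones: they are visibly closed under complements.\<close>

definition tame :: "nat struct set \<Rightarrow> bool" where
  "tame S \<longleftrightarrow> analytic (decode -` S) \<and> analytic (decode -` (- S))"

lemma tame_not: "tame {M. P M} \<Longrightarrow> tame {M. \<not> P M}"
  by (simp add: tame_def Collect_neg_eq[symmetric] Compl_eq)

lemma tame_const: "tame {M. P}"
  by (cases P) (simp_all add: tame_def analytic_empty analytic_UNIV)

lemma tame_ex:
  assumes "countable J" "\<And>j. j \<in> J \<Longrightarrow> tame {M. P j M}"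
  shows "tame {M. \<exists>j\<in>J. P j M}"
proof (cases "J = {}")
  case True
  then show ?thesis using tame_const[of False] by simp
next
  case False
  let ?j = "from_nat_into J"
  have "tame {M. P (?j n) M}" for n by (simp add: False assms(2) from_nat_into)
  then have "analytic (\<Union>n. decode -` {M. P (?j n) M})" "analytic (\<Inter>n. decode -` (- {M. P (?j n) M}))"
    unfolding tame_def by (blast intro: analytic_UN analytic_INT)+
  moreover have "(\<exists>j\<in>J. P j M) \<longleftrightarrow> (\<exists>n. P (?j n) M)" for M
    by (subst (1) range_from_nat_into[OF False assms(1), symmetric]) simp
  then have "decode -` {M. \<exists>j\<in>J. P j M} = (\<Union>n. decode -` {M. P (?j n) M})"
    "decode -` (- {M. \<exists>j\<in>J. P j M}) = (\<Inter>n. decode -` (- {M. P (?j n) M}))"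
    by (simp_all add: set_eq_iff)
  ultimately show ?thesis by (simp only: tame_def)
qed

lemma tame_all:
  assumes "countable J" "\<And>j. j \<in> J \<Longrightarrow> tame {M. P j M}"
  shows "tame {M. \<forall>j\<in>J. P j M}"
  using tame_not[OF tame_ex[OF assms(1), of "\<lambda>j M. \<not> P j M"]] tame_not[OF assms(2)] by simp

lemma tame_conj:
  assumes "tame {M. P M}" "tame {M. Q M}"
  shows "tame {M. P M \<and> Q M}"
proof -
  have "tame {M. if b then P M else Q M}" for b using assms by (cases b) simp_all
  then have "tame {M. \<forall>b\<in>UNIV. if b then P M else Q M}" by (intro tame_all) simp_all
  then show ?thesis by (simp add: all_bool_eq conj_commute)
qed

lemma tame_disj: "tame {M. P M} \<Longrightarrow> tame {M. Q M} \<Longrightarrow> tame {M. P M \<or> Q M}"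
  using tame_not[OF tame_conj[OF tame_not tame_not]] by simp

lemma tame_iff:
  assumes "tame {M. P M}" "tame {M. Q M}"
  shows "tame {M. P M \<longleftrightarrow> Q M}"
proof -
  have "tame {M. (P M \<and> Q M) \<or> (\<not> P M \<and> \<not> Q M)}"
    by (intro tame_disj tame_conj tame_not assms)
  also have "{M. (P M \<and> Q M) \<or> (\<not> P M \<and> \<not> Q M)} = {M. P M \<longleftrightarrow> Q M}" by blast
  finally show ?thesis .
qed

text \<open>The zero set is closed, and its complement is the union of the closed sets where the
  absolute value is at least 1/(n+1).\<close>

lemma analytic_zero_nonzero:
  fixes g :: "'a::topological_space \<Rightarrow> real"
  assumes g: "continuous_on UNIV g"
  shows "analytic {p. g p = 0}" "analytic {p. g p \<noteq> 0}"
proof -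
  show "analytic {p. g p = 0}"
    using closed_vimage_continuous[OF closed_singleton g] by (intro analytic_closed) simp
  have "analytic (\<Union>n. {p. inverse (real (Suc n)) \<le> \<bar>g p\<bar>})"
    by (intro analytic_UN analytic_closed closed_Collect_le continuous_on_const continuous_on_rabs g)
  moreover have "(\<Union>n. {p. inverse (real (Suc n)) \<le> \<bar>g p\<bar>}) = {p. g p \<noteq> 0}"
    using reals_Archimedean[of "\<bar>g _\<bar>"] by (auto intro: less_imp_le)
  ultimately show "analytic {p. g p \<noteq> 0}" by simp
qed

lemma tame_dom: "tame {M. n \<in> dom_of M}"
proof -
  have "continuous_on UNIV (\<lambda>p :: (nat \<Rightarrow> real) \<times> (nat \<times> nat \<Rightarrow> real). fst p n)"
    by (rule continuous_on_product_then_coordinatewise[OF continuous_on_fst[OF continuous_on_id]])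
  from analytic_zero_nonzero[OF this] show ?thesis by (simp add: tame_def decode_def vimage_def)
qed

lemma tame_le: "tame {M. m \<in> le_of M}"
proof -
  have "continuous_on UNIV (\<lambda>p :: (nat \<Rightarrow> real) \<times> (nat \<times> nat \<Rightarrow> real). snd p m)"
    by (rule continuous_on_product_then_coordinatewise[OF continuous_on_snd[OF continuous_on_id]])
  from analytic_zero_nonzero[OF this] show ?thesis by (simp add: tame_def decode_def vimage_def)
qed

lemma tame_sat: "tame {M. sat M e \<phi>}"
proof (induction \<phi> arbitrary: e)
  case (Ex x \<phi>)
  have "tame {M. \<exists>a\<in>UNIV. a \<in> dom_of M \<and> sat M (e(x := a)) \<phi>}"
    by (intro tame_ex tame_conj tame_dom Ex) simp
  then show ?case by (simp add: Bex_def)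
qed (simp_all only: sat.simps tame_const tame_le tame_not tame_conj)

lemma tame_models:
  assumes "T \<subseteq> sentences"
  shows "tame {M :: nat struct. is_model M T}"
proof -
  have struct: "is_struct M \<longleftrightarrow> (\<exists>n\<in>UNIV. n \<in> dom_of M) \<and>
      (\<forall>m\<in>UNIV. m \<notin> le_of M \<or> fst m \<in> dom_of M \<and> snd m \<in> dom_of M)" for M :: "nat struct"
    by (auto simp: is_struct_def)
  \<comment> \<open>\<open>holds\<close> quantifies over uncountably many assignments. For a
    sentence one constant assignment decides, which leaves a countable quantifier.\<close>
  have "holds M \<phi> \<longleftrightarrow> (\<exists>a\<in>UNIV. a \<in> dom_of M \<and> sat M (\<lambda>_. a) \<phi>)"
    if "is_struct M" "\<phi> \<in> T" for M :: "nat struct" and \<phi>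
  proof -
    have h: "holds M \<phi> \<longleftrightarrow> sat M (\<lambda>_. a) \<phi>" if "a \<in> dom_of M" for a
      using that \<open>\<phi> \<in> T\<close> assms by (intro holds_sentence) auto
    have "\<exists>a. a \<in> dom_of M" using \<open>is_struct M\<close> by (auto simp: is_struct_def)
    with h show ?thesis by auto
  qed
  then have "{M :: nat struct. is_model M T} = {M. is_struct M \<and>
      (\<forall>\<phi>\<in>T. \<exists>a\<in>UNIV. a \<in> dom_of M \<and> sat M (\<lambda>_. a) \<phi>)}"
    unfolding is_model_def by blast
  then show ?thesis
    unfolding struct
    by (simp only:) (intro tame_conj tame_all tame_ex tame_disj tame_not tame_dom tame_le tame_sat countableI_type)
qed

text \<open>The dichotomy for codes, carried over to structures: the invariant of \<open>M\<close>
  is the set of those of countably many tame properties that it has.\<close>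

lemma tame_dichotomy:
  fixes J :: "'j set"
  assumes J: "countable J" and A: "tame A" and Q: "\<And>j. j \<in> J \<Longrightarrow> tame {M. Q j M}"
  shows "countable ((\<lambda>M. {j \<in> J. Q j M}) ` A) \<or>
    |UNIV :: (nat \<Rightarrow> bool) set| \<le>o |(\<lambda>M. {j \<in> J. Q j M}) ` A|"
proof (cases "J = {}")
  case True
  then show ?thesis by (simp add: image_constant_conv)
next
  case False
  define F where "F M = {j \<in> J. Q j M}" for M
  \<comment> \<open>An enumeration of \<open>J\<close> turns a subset of \<open>J\<close> into a 0-1
    sequence, injectively on \<open>Pow J\<close>.\<close>
  define \<phi> where "\<phi> D = (\<lambda>n. from_nat_into J n \<in> D)" for D
  define S where "S n = decode -` {M. Q (from_nat_into J n) M}" for n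
  have "tame {M. Q (from_nat_into J n) M}" for n by (simp add: False Q from_nat_into)
  then have S: "analytic (S n)" "analytic (- S n)" for n
    by (simp_all add: S_def tame_def vimage_Compl)
  have "analytic (decode -` A)" using A by (simp add: tame_def)
  from analytic_image_dichotomy[OF this S]
  have dich: "countable ((\<lambda>x n. x \<in> S n) ` (decode -` A)) \<or>
    |UNIV :: (nat \<Rightarrow> bool) set| \<le>o |(\<lambda>x n. x \<in> S n) ` (decode -` A)|" .
  have "(\<lambda>n. x \<in> S n) = \<phi> (F (decode x))" for x
    using False by (auto simp: S_def \<phi>_def F_def from_nat_into)
  then have "(\<lambda>x n. x \<in> S n) ` (decode -` A) = \<phi> ` F ` decode ` (decode -` A)"
    by (simp only: image_image)
  also have "decode ` (decode -` A) = A" by (rule surj_image_vimage_eq[OF surj_decode])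
  finally have eq: "(\<lambda>x n. x \<in> S n) ` (decode -` A) = \<phi> ` F ` A" .
  have "inj_on \<phi> (Pow J)"
  proof (rule inj_onI)
    fix D D' assume D: "D \<in> Pow J" "D' \<in> Pow J" "\<phi> D = \<phi> D'"
    have "j \<in> D \<longleftrightarrow> j \<in> D'" if "j \<in> J" for j
      using fun_cong[OF D(3), of "to_nat_on J j"] that J by (simp add: \<phi>_def)
    then show "D = D'" using D by blast
  qed
  then have "inj_on \<phi> (F ` A)" by (rule inj_on_subset) (auto simp: F_def)
  then have "countable (\<phi> ` F ` A) \<Longrightarrow> countable (F ` A)" using countable_image_inj_on by blast
  moreover have "|\<phi> ` F ` A| \<le>o |F ` A|" by (rule card_of_image)
  ultimately show ?thesis using dich ordLeq_transitive unfolding eq F_def by blast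
qed

lemma countable_iff_natLeq: "countable A \<longleftrightarrow> |A| \<le>o natLeq"
proof -
  have "countable A \<longleftrightarrow> |A| \<le>o |UNIV :: nat set|"
    by (auto simp: countable_def card_of_ordLeq[symmetric])
  then show ?thesis using card_of_nat ordLeq_ordIso_trans ordIso_symmetric by blast
qed

section \<open>Back-and-forth equivalences of countable rank\<close>

text \<open>\<open>cardSuc natLeq\<close> orders sets of natural numbers, so elements of type
  \<open>nat set\<close> play the role of countable ordinals.\<close>

definition omega1 :: "nat set rel" where
  "omega1 = cardSuc natLeq"

abbreviation omega1_less :: "nat set \<Rightarrow> nat set \<Rightarrow> bool" (infix \<open>\<sqsubset>\<close> 50) where
  "\<alpha> \<sqsubset> \<beta> \<equiv> (\<alpha>, \<beta>) \<in> omega1 - Id"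

lemma Card_order_omega1: "Card_order omega1"
  unfolding omega1_def by (rule cardSuc_Card_order[OF natLeq_Card_order])

lemma Well_order_omega1: "Well_order omega1"
  using Card_order_omega1 by (rule Card_order_wo_rel[unfolded wo_rel_def])

lemma infinite_Field_omega1: "infinite (Field omega1)"
  unfolding omega1_def using cardSuc_finite[OF natLeq_Card_order] by (simp add: Field_natLeq)

lemma wf_omega1: "wf (omega1 - Id)"
  using Well_order_omega1 by (simp add: well_order_on_def)

lemma omega1_order: "trans omega1" "antisym omega1" "x \<in> Field omega1 \<Longrightarrow> (x, x) \<in> omega1"
  using Well_order_omega1
  unfolding well_order_on_def linear_order_on_def partial_order_on_def preorder_on_def refl_on_def
  by auto

lemma omega1_less_trans: "\<alpha> \<sqsubset> \<beta> \<Longrightarrow> \<beta> \<sqsubset> \<gamma> \<Longrightarrow> \<alpha> \<sqsubset> \<gamma>"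
  using trans_diff_Id[OF omega1_order(1,2)] by (rule transD)

text \<open>An initial segment has cardinality below the successor of \<open>natLeq\<close>, hence
  at most \<open>natLeq\<close>. Outside the field nothing lies below
  \<open>\<alpha>\<close>.\<close>

lemma countable_omega1_below: "countable {\<beta>. \<beta> \<sqsubset> \<alpha>}"
proof (cases "\<alpha> \<in> Field omega1")
  case True
  have "|underS omega1 \<alpha>| <o cardSuc natLeq"
    using card_of_underS[OF Card_order_omega1 True] by (simp add: omega1_def)
  then have "|underS omega1 \<alpha>| \<le>o natLeq"
    using cardSuc_ordLeq_ordLess[OF natLeq_Card_order card_of_Card_order] by blast
  then have "countable (underS omega1 \<alpha>)" by (simp add: countable_iff_natLeq)
  moreover have "{\<beta>. \<beta> \<sqsubset> \<alpha>} = underS omega1 \<alpha>" by (auto simp: underS_def)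
  ultimately show ?thesis by simp
next
  case False
  then have "{\<beta>. \<beta> \<sqsubset> \<alpha>} = {}" by (auto simp: Field_def)
  then show ?thesis by (simp only: countable_empty)
qed

text \<open>Regularity of a successor cardinal: a countable set covered by the increasing chain of
  initial segments lies in one of them. As \<open>omega1\<close> has no last element, the bound can
  be made strict.\<close>

lemma omega1_upper_bound:
  assumes "countable B" "B \<subseteq> Field omega1"
  obtains \<gamma> where "\<gamma> \<in> Field omega1" "\<And>\<beta>. \<beta> \<in> B \<Longrightarrow> \<beta> \<sqsubset> \<gamma>"
proof -
  have "relChain omega1 (under omega1)"
    unfolding relChain_def under_def using omega1_order(1) by (auto dest: transD)
  moreover have "B \<subseteq> (\<Union>i\<in>Field omega1. under omega1 i)"
    using assms(2) omega1_order(3) unfolding under_def by blast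
  moreover have "|B| \<le>o natLeq" using assms(1) by (simp add: countable_iff_natLeq)
  ultimately obtain \<delta> where \<delta>: "\<delta> \<in> Field omega1" "B \<subseteq> under omega1 \<delta>"
    using cardSuc_UNION[OF natLeq_Card_order, of "under omega1" B]
    by (auto simp: Field_natLeq omega1_def)
  obtain \<gamma> where \<gamma>: "\<gamma> \<in> Field omega1" "\<delta> \<noteq> \<gamma>" "(\<delta>, \<gamma>) \<in> omega1"
    using infinite_Card_order_limit[OF Card_order_omega1 infinite_Field_omega1 \<delta>(1)] by blast
  show thesis
  proof (rule that[OF \<gamma>(1)])
    fix \<beta> assume "\<beta> \<in> B"
    then have "(\<beta>, \<delta>) \<in> omega1" using \<delta>(2) by (auto simp: under_def)
    then show "\<beta> \<sqsubset> \<gamma>" using \<gamma> omega1_order(1,2) by (auto dest: transD antisymD)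
  qed
qed

section \<open>Back-and-forth relations between finite tuples\<close>

type_synonym tuple = "nat struct \<times> nat list"

definition same_atoms :: "tuple \<Rightarrow> tuple \<Rightarrow> bool" where
  "same_atoms p q \<longleftrightarrow> length (snd p) = length (snd q) \<and>
     (\<forall>i<length (snd p). \<forall>j<length (snd p).
        (snd p ! i = snd p ! j \<longleftrightarrow> snd q ! i = snd q ! j) \<and>
        ((snd p ! i, snd p ! j) \<in> le_of (fst p) \<longleftrightarrow> (snd q ! i, snd q ! j) \<in> le_of (fst q)))"

text \<open>
  One step adds a whole finite tuple instead of a single element; a structure is then determined by
  its class two ranks above a stable one, and no limit rank is needed.
\<close>

definition forth :: "(tuple \<Rightarrow> tuple \<Rightarrow> bool) \<Rightarrow> tuple \<Rightarrow> tuple \<Rightarrow> bool" where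
  "forth R p q \<longleftrightarrow> (\<forall>c\<in>lists (dom_of (fst p)). \<exists>d\<in>lists (dom_of (fst q)).
     R (fst p, snd p @ c) (fst q, snd q @ d))"

text \<open>All lower ranks are treated in one clause, without separate zero, successor and limit
  cases. A rank outside \<open>Field omega1\<close> has nothing below it, and there the relation is
  \<open>same_atoms\<close>.\<close>

definition beq :: "nat set \<Rightarrow> tuple \<Rightarrow> tuple \<Rightarrow> bool" where
  "beq = wfrec (omega1 - Id) (\<lambda>E \<alpha> p q. same_atoms p q \<and>
     (\<forall>\<beta>. \<beta> \<sqsubset> \<alpha> \<longrightarrow> forth (E \<beta>) p q \<and> forth (E \<beta>) q p))"

lemma beq_iff:
  "beq \<alpha> p q \<longleftrightarrow> same_atoms p q \<and> (\<forall>\<beta>. \<beta> \<sqsubset> \<alpha> \<longrightarrow> forth (beq \<beta>) p q \<and> forth (beq \<beta>) q p)"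
proof -
  have "cut beq (omega1 - Id) \<alpha> \<beta> = beq \<beta>" if "\<beta> \<sqsubset> \<alpha>" for \<beta> using that by (rule cut_apply)
  then show ?thesis
    using def_wfrec[OF beq_def[THEN eq_reflection] wf_omega1, of \<alpha>] by simp
qed

lemma same_atoms_refl: "same_atoms p p"
  by (simp add: same_atoms_def)

lemma same_atoms_sym: "same_atoms p q \<Longrightarrow> same_atoms q p"
  by (simp add: same_atoms_def)

lemma same_atoms_trans: "same_atoms p q \<Longrightarrow> same_atoms q s \<Longrightarrow> same_atoms p s"
  by (simp add: same_atoms_def)

lemma beq_refl: "beq \<alpha> p p"
proof (induction \<alpha> arbitrary: p rule: wf_induct_rule[OF wf_omega1])
  case (1 \<alpha>)
  then show ?case unfolding beq_iff[of \<alpha>] forth_def using same_atoms_refl by blast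
qed

lemma beq_sym: "beq \<alpha> p q \<Longrightarrow> beq \<alpha> q p"
  unfolding beq_iff[of \<alpha>] using same_atoms_sym by blast

lemma beq_trans: "beq \<alpha> p q \<Longrightarrow> beq \<alpha> q s \<Longrightarrow> beq \<alpha> p s"
proof (induction \<alpha> arbitrary: p q s rule: wf_induct_rule[OF wf_omega1])
  case (1 \<alpha>)
  have forth: "forth (beq \<beta>) x z" if "\<beta> \<sqsubset> \<alpha>" "forth (beq \<beta>) x y" "forth (beq \<beta>) y z" for \<beta> x y z
    using that(2,3) 1(1)[OF that(1)] unfolding forth_def by meson
  from 1(2,3) show ?case unfolding beq_iff[of \<alpha>] using same_atoms_trans forth by meson
qed

lemma beq_mono: "beq \<alpha> p q \<Longrightarrow> \<beta> \<sqsubset> \<alpha> \<Longrightarrow> beq \<beta> p q"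
  unfolding beq_iff[of \<alpha>] beq_iff[of \<beta>] using omega1_less_trans by blast

lemma beq_iso:
  assumes h: "is_iso M N h" and "a \<in> lists (dom_of M)"
  shows "beq \<alpha> (M, a) (N, map h a)"
  using assms(2)
proof (induction \<alpha> arbitrary: a rule: wf_induct_rule[OF wf_omega1])
  case (1 \<alpha>)
  have inj: "inj_on h (dom_of M)" and im: "h ` dom_of M = dom_of N"
    and le: "\<And>x y. x \<in> dom_of M \<Longrightarrow> y \<in> dom_of M \<Longrightarrow> (x, y) \<in> le_of M \<longleftrightarrow> (h x, h y) \<in> le_of N"
    using h by (auto simp: is_iso_def bij_betw_def)
  have nth: "a ! i \<in> dom_of M" if "i < length a" for i
    using that "1.prems" by (auto simp: in_lists_conv_set)
  then have atoms: "same_atoms (M, a) (N, map h a)"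
    using inj le by (auto simp: same_atoms_def inj_on_def)
  have step: "beq \<beta> (M, a @ c) (N, map h a @ map h c)" if "\<beta> \<sqsubset> \<alpha>" "c \<in> lists (dom_of M)" for \<beta> c
    using "1.IH"[OF that(1), of "a @ c"] that(2) "1.prems" by simp
  have "map h c \<in> lists (dom_of N)" if "c \<in> lists (dom_of M)" for c
    using that im by (auto simp: in_lists_conv_set)
  moreover have "\<exists>c\<in>lists (dom_of M). d = map h c" if "d \<in> lists (dom_of N)" for d
  proof -
    have "d \<in> map h ` lists (dom_of M)" using that unfolding im[symmetric] lists_image .
    then show ?thesis by blast
  qed
  ultimately have "forth (beq \<beta>) (M, a) (N, map h a)" "forth (beq \<beta>) (N, map h a) (M, a)"
    if "\<beta> \<sqsubset> \<alpha>" for \<beta>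
    using step[OF that] beq_sym unfolding forth_def fst_conv snd_conv by metis+
  with atoms show ?case unfolding beq_iff[of \<alpha>] by blast
qed

text \<open>Cantor's argument: the lists are extended forever, and stage \<open>n\<close> puts the
  number \<open>n\<close> into both of them where it belongs to the domain. The union of the finite
  correspondences is an isomorphism.\<close>

lemma back_and_forth_iso:
  fixes M N :: "nat struct"
  assumes base: "S [] []"
    and atoms: "\<And>a b. S a b \<Longrightarrow> same_atoms (M, a) (N, b)"
    and dom: "\<And>a b. S a b \<Longrightarrow> set a \<subseteq> dom_of M \<and> set b \<subseteq> dom_of N"
    and left: "\<And>a b c. S a b \<Longrightarrow> c \<in> dom_of M \<Longrightarrow> \<exists>d. S (a @ [c]) (b @ [d])"
    and right: "\<And>a b d. S a b \<Longrightarrow> d \<in> dom_of N \<Longrightarrow> \<exists>c. S (a @ [c]) (b @ [d])"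
  shows "M \<cong>\<^sub>s N"
proof -
  define ext where "ext p q \<longleftrightarrow> (\<exists>x y. fst q = fst p @ x \<and> snd q = snd p @ y)" for p q :: "nat list \<times> nat list"
  have ext_trans: "ext p s" if "ext p q" "ext q s" for p q s using that unfolding ext_def by auto
  have ext_refl: "ext p p" for p unfolding ext_def by auto
  have l: "\<exists>q. S (fst q) (snd q) \<and> ext p q \<and> (n \<in> dom_of M \<longrightarrow> n \<in> set (fst q))"
    if p: "S (fst p) (snd p)" for p n
  proof (cases "n \<in> dom_of M")
    case True
    then obtain d where "S (fst p @ [n]) (snd p @ [d])" using left[OF p] by blast
    then show ?thesis by (intro exI[of _ "(fst p @ [n], snd p @ [d])"]) (auto simp: ext_def)
  qed (use p ext_refl in blast)
  have r: "\<exists>q. S (fst q) (snd q) \<and> ext p q \<and> (n \<in> dom_of N \<longrightarrow> n \<in> set (snd q))"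
    if p: "S (fst p) (snd p)" for p n
  proof (cases "n \<in> dom_of N")
    case True
    then obtain c where "S (fst p @ [c]) (snd p @ [n])" using right[OF p] by blast
    then show ?thesis by (intro exI[of _ "(fst p @ [c], snd p @ [n])"]) (auto simp: ext_def)
  qed (use p ext_refl in blast)
  have "\<exists>f. \<forall>n. S (fst (f n)) (snd (f n)) \<and> (ext (f n) (f (Suc n)) \<and>
      (n \<in> dom_of M \<longrightarrow> n \<in> set (fst (f (Suc n)))) \<and> (n \<in> dom_of N \<longrightarrow> n \<in> set (snd (f (Suc n)))))"
  proof (rule dependent_nat_choice)
    show "\<exists>p. S (fst p) (snd p)" using base by (intro exI[of _ "([], [])"]) simp
    fix p n assume "S (fst p) (snd p)"
    then obtain q where q: "S (fst q) (snd q)" "ext p q" "n \<in> dom_of M \<longrightarrow> n \<in> set (fst q)" using l by blast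
    obtain s where s: "S (fst s) (snd s)" "ext q s" "n \<in> dom_of N \<longrightarrow> n \<in> set (snd s)" using r[OF q(1)] by blast
    have "set (fst q) \<subseteq> set (fst s)" using s(2) by (auto simp: ext_def)
    then show "\<exists>s. S (fst s) (snd s) \<and> (ext p s \<and> (n \<in> dom_of M \<longrightarrow> n \<in> set (fst s)) \<and>
        (n \<in> dom_of N \<longrightarrow> n \<in> set (snd s)))"
      using q s ext_trans by blast
  qed
  then obtain f where S: "\<And>n. S (fst (f n)) (snd (f n))" and ext1: "\<And>n. ext (f n) (f (Suc n))"
    and inM: "\<And>n. n \<in> dom_of M \<Longrightarrow> n \<in> set (fst (f (Suc n)))"
    and inN: "\<And>n. n \<in> dom_of N \<Longrightarrow> n \<in> set (snd (f (Suc n)))"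
    by blast
  have ext: "ext (f m) (f n)" if "m \<le> n" for m n
    using that
  proof (induction rule: dec_induct)
    case (step k)
    then show ?case using ext_trans ext1 by blast
  qed (rule ext_refl)
  have len: "length (fst (f n)) = length (snd (f n))" for n
    using atoms[OF S] by (simp add: same_atoms_def)
  define \<rho> where "\<rho> x y \<longleftrightarrow> (\<exists>n. \<exists>i<length (fst (f n)). fst (f n) ! i = x \<and> snd (f n) ! i = y)" for x y
  have up: "\<exists>i<length (fst (f m)). fst (f m) ! i = fst (f n) ! k \<and> snd (f m) ! i = snd (f n) ! k"
    if nm: "n \<le> m" "k < length (fst (f n))" for n m k
  proof -
    obtain x y where "fst (f m) = fst (f n) @ x" "snd (f m) = snd (f n) @ y"
      using ext[OF nm(1)] by (auto simp: ext_def)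
    then show ?thesis using nm(2) len[of n] by (intro exI[of _ k]) (auto simp: nth_append)
  qed
  \<comment> \<open>Two pairs may enter at different stages; they are compared in the later one,
    which still contains both at their positions.\<close>
  have key: "(x = x' \<longleftrightarrow> y = y') \<and> ((x, x') \<in> le_of M \<longleftrightarrow> (y, y') \<in> le_of N)" if \<rho>: "\<rho> x y" "\<rho> x' y'" for x y x' y'
  proof -
    obtain n k where n: "k < length (fst (f n))" "fst (f n) ! k = x" "snd (f n) ! k = y"
      using \<rho>(1) by (auto simp: \<rho>_def)
    obtain n' k' where n': "k' < length (fst (f n'))" "fst (f n') ! k' = x'" "snd (f n') ! k' = y'"
      using \<rho>(2) by (auto simp: \<rho>_def)
    define m where "m = max n n'"
    obtain i where i: "i < length (fst (f m))" "fst (f m) ! i = x" "snd (f m) ! i = y"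
      using up[of n m k] n by (auto simp: m_def)
    obtain i' where i': "i' < length (fst (f m))" "fst (f m) ! i' = x'" "snd (f m) ! i' = y'"
      using up[of n' m k'] n' by (auto simp: m_def)
    show ?thesis using atoms[OF S, of m] i i' unfolding same_atoms_def by auto
  qed
  have total: "\<exists>y. \<rho> x y" if "x \<in> dom_of M" for x
    using inM[OF that] unfolding \<rho>_def in_set_conv_nth by blast
  have onto: "\<exists>x. \<rho> x y" if "y \<in> dom_of N" for y
    using inN[OF that] len unfolding \<rho>_def in_set_conv_nth by metis
  have \<rho>_dom: "x \<in> dom_of M \<and> y \<in> dom_of N" if xy: "\<rho> x y" for x y
  proof -
    obtain n k where "k < length (fst (f n))" "fst (f n) ! k = x" "snd (f n) ! k = y"
      using xy by (auto simp: \<rho>_def)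
    then show ?thesis using dom[OF S, of n] len[of n] nth_mem by (metis subsetD)
  qed
  obtain h where h: "\<And>x. x \<in> dom_of M \<Longrightarrow> \<rho> x (h x)" using total by metis
  have "inj_on h (dom_of M)" using key[OF h h] by (auto intro: inj_onI)
  moreover have "h ` dom_of M = dom_of N"
  proof
    show "h ` dom_of M \<subseteq> dom_of N" using h \<rho>_dom by blast
    show "dom_of N \<subseteq> h ` dom_of M"
    proof
      fix y assume "y \<in> dom_of N"
      then obtain x where x: "\<rho> x y" using onto by blast
      then have "x \<in> dom_of M" using \<rho>_dom by blast
      moreover have "h x = y" using key[OF h[OF \<open>x \<in> dom_of M\<close>] x] by simp
      ultimately show "y \<in> h ` dom_of M" by blast
    qed
  qed
  ultimately have "is_iso M N h" using key[OF h h] by (auto simp: is_iso_def bij_betw_def)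
  then show ?thesis by (auto simp: isomorphic_def)
qed

text \<open>A bound on the Scott rank: above \<open>\<gamma>\<close> the equivalence between tuples
  of \<open>M\<close> itself does not get finer.\<close>

definition stable_rank :: "nat struct \<Rightarrow> nat set \<Rightarrow> bool" where
  "stable_rank M \<gamma> \<longleftrightarrow> (\<forall>a\<in>lists (dom_of M). \<forall>b\<in>lists (dom_of M).
     beq \<gamma> (M, a) (M, b) \<longrightarrow> (\<forall>\<alpha>\<in>Field omega1. beq \<alpha> (M, a) (M, b)))"

text \<open>Each pair of tuples that is ever separated is separated at some rank. There are
  countably many pairs, so one rank lies above all the chosen ones.\<close>

lemma ex_stable_rank: "\<exists>\<gamma>\<in>Field omega1. stable_rank M \<gamma>"
proof -
  have ne: "\<exists>\<alpha>. \<alpha> \<in> Field omega1" using infinite_Field_omega1 by (metis all_not_in_conv finite.emptyI)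
  have "\<exists>\<alpha>. \<alpha> \<in> Field omega1 \<and> ((\<exists>\<beta>\<in>Field omega1. \<not> beq \<beta> (M, a) (M, b)) \<longrightarrow> \<not> beq \<alpha> (M, a) (M, b))" for a b
    using ne by blast
  then obtain r where r: "\<And>a b. r a b \<in> Field omega1"
    "\<And>a b. (\<exists>\<beta>\<in>Field omega1. \<not> beq \<beta> (M, a) (M, b)) \<Longrightarrow> \<not> beq (r a b) (M, a) (M, b)"
    by metis
  have "countable (range (\<lambda>(a, b). r a b))" by (intro countable_image) simp
  moreover have "range (\<lambda>(a, b). r a b) \<subseteq> Field omega1" using r(1) by auto
  ultimately obtain \<gamma> where \<gamma>: "\<gamma> \<in> Field omega1" "\<And>\<beta>. \<beta> \<in> range (\<lambda>(a, b). r a b) \<Longrightarrow> \<beta> \<sqsubset> \<gamma>"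
    using omega1_upper_bound by metis
  have "r a b \<sqsubset> \<gamma>" for a b by (rule \<gamma>(2)) (rule image_eqI[of _ _ "(a, b)"], auto)
  then have "stable_rank M \<gamma>" unfolding stable_rank_def using r(2) beq_mono by meson
  with \<gamma>(1) show ?thesis by blast
qed

text \<open>The \<open>\<gamma>\<close>-equivalent pairs of tuples form a back-and-forth system:
  stability raises the equivalence to \<open>\<delta>\<close>, and one step down from
  \<open>\<delta>\<close> to \<open>\<gamma>\<close> extends the tuples.\<close>

lemma beq_above_stable_rank_iso:
  fixes M N :: "nat struct"
  assumes st: "stable_rank M \<gamma>" and lt: "\<gamma> \<sqsubset> \<delta>" "\<delta> \<sqsubset> \<epsilon>" and eq: "beq \<epsilon> (M, []) (N, [])"
  shows "M \<cong>\<^sub>s N"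
proof (rule back_and_forth_iso[where S = "\<lambda>a b. a \<in> lists (dom_of M) \<and> b \<in> lists (dom_of N) \<and> beq \<gamma> (M, a) (N, b)"])
  have \<delta>: "\<delta> \<in> Field omega1" using lt by (auto simp: Field_def)
  \<comment> \<open>The rank \<open>\<epsilon>\<close> yields a tuple \<open>a'\<close> of
    \<open>M\<close> that is \<open>\<delta>\<close>-equivalent to \<open>b\<close>. Then
    \<open>a\<close> and \<open>a'\<close> are \<open>\<gamma>\<close>-equivalent inside
    \<open>M\<close>, where stability applies.\<close>
  have up: "beq \<delta> (M, a) (N, b)"
    if ab: "a \<in> lists (dom_of M)" "b \<in> lists (dom_of N)" "beq \<gamma> (M, a) (N, b)" for a b
  proof -
    have "forth (beq \<delta>) (N, []) (M, [])" using eq lt(2) unfolding beq_iff[of \<epsilon>] by blast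
    then obtain a' where a': "a' \<in> lists (dom_of M)" "beq \<delta> (N, b) (M, a')"
      using ab(2) unfolding forth_def fst_conv snd_conv append_Nil by blast
    have "beq \<gamma> (M, a) (M, a')" using ab(3) beq_mono[OF a'(2) lt(1)] by (rule beq_trans)
    then have "beq \<delta> (M, a) (M, a')" using st ab(1) a'(1) \<delta> unfolding stable_rank_def by blast
    then show ?thesis using beq_sym[OF a'(2)] by (rule beq_trans)
  qed
  have len: "length a = length b" if "beq \<alpha> (M', a) (N', b)" for \<alpha> M' N' a b
    using that unfolding beq_iff[of \<alpha>] same_atoms_def by simp
  \<comment> \<open>A step answers with a whole tuple. Since \<open>same_atoms\<close> compares
    lengths, a single element is answered by a single element.\<close>
  have single: "\<exists>z. y = [z]" if "beq \<alpha> (M', a @ [x]) (N', b @ y)" "beq \<alpha>' (M', a) (N', b)"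
    for \<alpha> \<alpha>' M' N' a b x y
    using len[OF that(1)] len[OF that(2)] by (cases y) auto
  show "[] \<in> lists (dom_of M) \<and> [] \<in> lists (dom_of N) \<and> beq \<gamma> (M, []) (N, [])"
    using beq_mono[OF beq_mono[OF eq lt(2)] lt(1)] by simp
  show "same_atoms (M, a) (N, b)"
    if "a \<in> lists (dom_of M) \<and> b \<in> lists (dom_of N) \<and> beq \<gamma> (M, a) (N, b)" for a b
    using that unfolding beq_iff[of \<gamma>] by blast
  show "set a \<subseteq> dom_of M \<and> set b \<subseteq> dom_of N"
    if "a \<in> lists (dom_of M) \<and> b \<in> lists (dom_of N) \<and> beq \<gamma> (M, a) (N, b)" for a b
    using that by (auto simp: in_lists_conv_set)
  show "\<exists>d. a @ [c] \<in> lists (dom_of M) \<and> b @ [d] \<in> lists (dom_of N) \<and> beq \<gamma> (M, a @ [c]) (N, b @ [d])"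
    if ab: "a \<in> lists (dom_of M) \<and> b \<in> lists (dom_of N) \<and> beq \<gamma> (M, a) (N, b)" and c: "c \<in> dom_of M" for a b c
  proof -
    have "forth (beq \<gamma>) (M, a) (N, b)" using up ab lt(1) unfolding beq_iff[of \<delta>] by blast
    moreover have "[c] \<in> lists (dom_of M)" using c by simp
    ultimately obtain y where y: "y \<in> lists (dom_of N)" "beq \<gamma> (M, a @ [c]) (N, b @ y)"
      unfolding forth_def fst_conv snd_conv by blast
    moreover obtain d where "y = [d]" using single[OF y(2)] ab by blast
    ultimately show ?thesis using ab c by auto
  qed
  show "\<exists>c. a @ [c] \<in> lists (dom_of M) \<and> b @ [d] \<in> lists (dom_of N) \<and> beq \<gamma> (M, a @ [c]) (N, b @ [d])"
    if ab: "a \<in> lists (dom_of M) \<and> b \<in> lists (dom_of N) \<and> beq \<gamma> (M, a) (N, b)" and d: "d \<in> dom_of N" for a b d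
  proof -
    have "forth (beq \<gamma>) (N, b) (M, a)" using up ab lt(1) unfolding beq_iff[of \<delta>] by blast
    moreover have "[d] \<in> lists (dom_of N)" using d by simp
    ultimately obtain y where y: "y \<in> lists (dom_of M)" "beq \<gamma> (N, b @ [d]) (M, a @ y)"
      unfolding forth_def fst_conv snd_conv by blast
    moreover obtain c where "y = [c]" using single[OF y(2)] ab beq_sym by blast
    ultimately show ?thesis using ab d beq_sym[OF y(2)] by auto
  qed
qed

section \<open>Morley's theorem on the number of countable models\<close>

text \<open>Numbering each fibre embeds \<open>A\<close> into \<open>B \<times> nat\<close>. As
  \<open>A\<close> is uncountable, \<open>B\<close> is infinite, and the factor \<open>nat\<close>
  is absorbed.\<close>

lemma ordLeq_countable_fibres:
  assumes f: "f ` A \<subseteq> B" and fib: "\<And>y. y \<in> B \<Longrightarrow> countable {x \<in> A. f x = y}" and unc: "uncountable A"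
  shows "|A| \<le>o |B|"
proof -
  have "A \<subseteq> (\<Union>y\<in>B. {x \<in> A. f x = y})" using f by blast
  moreover have "countable (\<Union>y\<in>B. {x \<in> A. f x = y})" if "countable B"
    using that fib by (rule countable_UN)
  ultimately have "uncountable B" using unc countable_subset by metis
  then have inf: "infinite B" using countable_finite by metis
  define g where "g x = (f x, to_nat_on {z \<in> A. f z = f x} x)" for x
  have "inj_on g A"
  proof (rule inj_onI)
    fix x x' assume x: "x \<in> A" "x' \<in> A" "g x = g x'"
    then have eq: "f x = f x'" and "to_nat_on {z \<in> A. f z = f x'} x = to_nat_on {z \<in> A. f z = f x'} x'"
      by (auto simp: g_def)
    moreover have "countable {z \<in> A. f z = f x'}" by (rule fib) (use f x(2) in blast)
    ultimately show "x = x'" using x(1,2) inj_onD[OF inj_on_to_nat_on] by auto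
  qed
  moreover have "g ` A \<subseteq> B \<times> (UNIV :: nat set)" using f by (auto simp: g_def)
  ultimately have "|A| \<le>o |B \<times> (UNIV :: nat set)|" using card_of_ordLeq by blast
  also have "|UNIV :: nat set| \<le>o |B|" using inf by (simp add: infinite_iff_card_of_nat)
  then have "|B \<times> (UNIV :: nat set)| =o |B|" using card_of_Times_infinite[OF inf, of "UNIV :: nat set"] by blast
  finally show ?thesis .
qed

lemma morley:
  fixes T :: "fm set"
  assumes T: "T \<subseteq> sentences"
  shows "num_models T \<le>o cardSuc natLeq \<or> |UNIV :: (nat \<Rightarrow> bool) set| \<le>o num_models T"
proof (rule disjCI)
  assume few: "\<not> |UNIV :: (nat \<Rightarrow> bool) set| \<le>o num_models T"
  define \<M> where "\<M> = {M :: nat struct. is_model M T}"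
  define L where "L = {p :: tuple. fst p \<in> \<M> \<and> snd p \<in> lists (dom_of (fst p))}"
  define E where "E \<alpha> = {(p, q). p \<in> L \<and> q \<in> L \<and> beq \<alpha> p q}" for \<alpha>
  define Md where "Md a = {M \<in> \<M>. a \<in> lists (dom_of M)}" for a :: "nat list"
  have L_iff: "(M, a) \<in> L \<longleftrightarrow> M \<in> Md a" for M a by (simp add: L_def Md_def)
  have eqv: "equiv L (E \<alpha>)" for \<alpha>
    by (rule equivI) (auto simp: E_def refl_on_def intro!: symI transI intro: beq_refl beq_sym beq_trans)
  have tame_Md: "tame (Md a)" for a
  proof -
    have "tame {M. is_model M T \<and> (\<forall>n\<in>set a. n \<in> dom_of M)}"
      by (intro tame_conj tame_models T tame_all tame_dom) (simp add: countable_finite)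
    then show ?thesis by (simp add: Md_def \<M>_def in_lists_conv_set)
  qed
  \<comment> \<open>The tuples with an extension in \<open>C\<close>. The list \<open>c\<close> may
    range over all lists, since classes \<open>C\<close> contained in \<open>L\<close> force its
    entries into the domain.\<close>
  define X where "X C = {p :: tuple. \<exists>c\<in>UNIV. (fst p, snd p @ c) \<in> C}" for C
  define atoms where "atoms = range (\<lambda>n. {p :: tuple. length (snd p) = n})
    \<union> range (\<lambda>(i, j). {p :: tuple. i < length (snd p) \<and> j < length (snd p) \<and> snd p ! i = snd p ! j})
    \<union> range (\<lambda>(i, j). {p :: tuple. i < length (snd p) \<and> j < length (snd p) \<and> (snd p ! i, snd p ! j) \<in> le_of (fst p)})"
  \<comment> \<open>Both halves of \<open>forth\<close> reduce to meeting the same classes of lower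
    rank by an extension, so that on \<open>L\<close> the relation \<open>beq \<alpha>\<close> means
    passing the same tests.\<close>
  define tests where "tests \<alpha> = atoms \<union> (\<Union>\<beta>\<in>{\<beta>. \<beta> \<sqsubset> \<alpha>}. X ` (L // E \<beta>))" for \<alpha>
  have atoms: "same_atoms p q \<longleftrightarrow> (\<forall>D\<in>atoms. p \<in> D \<longleftrightarrow> q \<in> D)" for p q
  proof
    show "same_atoms p q \<Longrightarrow> \<forall>D\<in>atoms. p \<in> D \<longleftrightarrow> q \<in> D"
      by (auto simp: atoms_def same_atoms_def)
    assume *: "\<forall>D\<in>atoms. p \<in> D \<longleftrightarrow> q \<in> D"
    then have len: "length (snd p) = length (snd q)" by (simp add: atoms_def ball_Un)
    show "same_atoms p q" using * by (simp add: atoms_def ball_Un same_atoms_def len) blast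
  qed
  have beq_tests: "beq \<alpha> p q \<longleftrightarrow> (\<forall>D\<in>tests \<alpha>. p \<in> D \<longleftrightarrow> q \<in> D)" if pq: "p \<in> L" "q \<in> L" for \<alpha> p q
  proof -
    have fo: "forth (beq \<beta>) p q \<longleftrightarrow> (\<forall>C\<in>L // E \<beta>. p \<in> X C \<longrightarrow> q \<in> X C)" if pq: "p \<in> L" "q \<in> L" for p q \<beta>
    proof
      assume f: "forth (beq \<beta>) p q"
      show "\<forall>C\<in>L // E \<beta>. p \<in> X C \<longrightarrow> q \<in> X C"
      proof (intro ballI impI)
        fix C assume C: "C \<in> L // E \<beta>" "p \<in> X C"
        then obtain c where c: "(fst p, snd p @ c) \<in> C" by (auto simp: X_def)
        then have cL: "(fst p, snd p @ c) \<in> L" using in_quotient_imp_subset[OF eqv C(1)] by blast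
        then have "c \<in> lists (dom_of (fst p))" by (simp add: L_def)
        then obtain d where d: "d \<in> lists (dom_of (fst q))" "beq \<beta> (fst p, snd p @ c) (fst q, snd q @ d)"
          using f unfolding forth_def by blast
        have "(fst q, snd q @ d) \<in> L" using d(1) pq(2) by (simp add: L_def)
        then have "((fst p, snd p @ c), (fst q, snd q @ d)) \<in> E \<beta>" using cL d(2) by (simp add: E_def)
        then have "(fst q, snd q @ d) \<in> C" using in_quotient_imp_closed[OF eqv C(1) c] by blast
        then show "q \<in> X C" by (auto simp: X_def)
      qed
    next
      assume *: "\<forall>C\<in>L // E \<beta>. p \<in> X C \<longrightarrow> q \<in> X C"
      show "forth (beq \<beta>) p q"
        unfolding forth_def
      proof
        fix c assume c: "c \<in> lists (dom_of (fst p))"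
        let ?C = "E \<beta> `` {(fst p, snd p @ c)}"
        have cL: "(fst p, snd p @ c) \<in> L" using c pq(1) by (simp add: L_def)
        have "?C \<in> L // E \<beta>" using cL by (rule quotientI)
        moreover have "p \<in> X ?C" using equiv_class_self[OF eqv cL] by (auto simp: X_def)
        ultimately have "q \<in> X ?C" using * by blast
        then obtain d where "((fst p, snd p @ c), (fst q, snd q @ d)) \<in> E \<beta>" by (auto simp: X_def)
        then show "\<exists>d\<in>lists (dom_of (fst q)). beq \<beta> (fst p, snd p @ c) (fst q, snd q @ d)"
          by (auto simp: E_def L_def intro!: bexI[of _ d])
      qed
    qed
    show ?thesis
      unfolding beq_iff[of \<alpha>] atoms fo[OF pq] fo[OF pq(2,1)] tests_def
      by (simp only: ball_Un ball_UN ball_simps mem_Collect_eq) (simp only: Ball_def mem_Collect_eq, blast)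
  qed
  \<comment> \<open>The code of the class of \<open>(M, a)\<close>: a subset of
    \<open>tests \<alpha>\<close>, hence a real as soon as there are countably many tests.\<close>
  define F where "F \<alpha> a M = {D \<in> tests \<alpha>. (M, a) \<in> D}" for \<alpha> a M
  have F_iff: "beq \<alpha> (M, a) (N, b) \<longleftrightarrow> F \<alpha> a M = F \<alpha> b N" if "M \<in> Md a" "N \<in> Md b" for \<alpha> a b M N
    using beq_tests[of "(M, a)" "(N, b)" \<alpha>] that unfolding F_def L_iff by blast
  have tame_atoms: "tame {M. (M, a) \<in> D}" if "D \<in> atoms" for a D
    using that unfolding atoms_def
    using tame_const[of True] tame_const[of False] by (auto intro!: tame_conj tame_const tame_le)
  \<comment> \<open>Both claims are needed together: countability of the lower classes makes the
    tests countable, their tameness makes the tests tame, and the dichotomy then controls the number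
    of codes at \<open>\<alpha>\<close>.\<close>
  have main: "countable (L // E \<alpha>) \<and> (\<forall>C\<in>L // E \<alpha>. \<forall>a. tame {M. (M, a) \<in> C})" for \<alpha>
  proof (induction \<alpha> rule: wf_induct_rule[OF wf_omega1])
    case (1 \<alpha>)
    have ct: "countable (tests \<alpha>)"
      unfolding tests_def atoms_def using 1 countable_omega1_below[of \<alpha>]
      by (intro countable_Un countable_UN countable_image) auto
    have tt: "tame {M. (M, a) \<in> D}" if D: "D \<in> tests \<alpha>" for a D
    proof (cases "D \<in> atoms")
      case True
      then show ?thesis by (rule tame_atoms)
    next
      case False
      then obtain \<beta> C where C: "\<beta> \<sqsubset> \<alpha>" "C \<in> L // E \<beta>" "D = X C" using D by (auto simp: tests_def)
      have "tame {M. \<exists>c\<in>UNIV. (M, a @ c) \<in> C}" using 1[OF C(1)] C(2) by (intro tame_ex) auto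
      then show ?thesis by (simp add: C(3) X_def)
    qed
    have cF: "countable (F \<alpha> a ` Md a)" for a
    proof (rule ccontr)
      assume unc: "uncountable (F \<alpha> a ` Md a)"
      then have big: "|UNIV :: (nat \<Rightarrow> bool) set| \<le>o |F \<alpha> a ` Md a|"
        using tame_dichotomy[OF ct tame_Md[of a], of "\<lambda>D M. (M, a) \<in> D"] tt unfolding F_def by blast
      \<comment> \<open>Each code \<open>v\<close> is sent to the isomorphism type of a model
        \<open>m v\<close> realising it at \<open>a\<close>. An isomorphism onto a representative
        \<open>N\<close> moves \<open>a\<close> to some tuple \<open>b\<close> of \<open>N\<close>
        with the same code, so a type is hit by countably many codes only. Continuum many codes
        would thus give continuum many types, against \<open>few\<close>.\<close>
      define m where "m = inv_into (Md a) (F \<alpha> a)"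
      have m: "m v \<in> Md a \<and> F \<alpha> a (m v) = v" if "v \<in> F \<alpha> a ` Md a" for v
        using that by (simp add: m_def inv_into_into f_inv_into_f)
      have "|F \<alpha> a ` Md a| \<le>o |\<M> // iso_rel|"
      proof (rule ordLeq_countable_fibres[where f = "\<lambda>v. iso_rel `` {m v}", OF _ _ unc])
        show "(\<lambda>v. iso_rel `` {m v}) ` F \<alpha> a ` Md a \<subseteq> \<M> // iso_rel"
          using m by (auto simp: Md_def intro!: quotientI)
        fix y assume "y \<in> \<M> // iso_rel"
        then obtain N where N: "N \<in> \<M>" "y = iso_rel `` {N}" by (rule quotientE)
        have "v \<in> range (\<lambda>b. F \<alpha> b N)" if v: "v \<in> F \<alpha> a ` Md a" "iso_rel `` {m v} = y" for v
        proof -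
          have "(m v, N) \<in> iso_rel" using v(2) N(2) eq_equiv_class[OF _ equiv_iso_rel] by blast
          then obtain h where h: "is_iso (m v) N h" by (auto simp: iso_rel_def isomorphic_def)
          have mv: "m v \<in> Md a" using m v(1) by blast
          then have a: "a \<in> lists (dom_of (m v))" by (simp add: Md_def)
          have "h x \<in> dom_of N" if "x \<in> dom_of (m v)" for x
            using h that by (auto simp: is_iso_def bij_betw_def)
          then have "map h a \<in> lists (dom_of N)" using a by (auto simp: in_lists_conv_set)
          then have "N \<in> Md (map h a)" using N(1) by (simp add: Md_def)
          then have "F \<alpha> a (m v) = F \<alpha> (map h a) N" using F_iff[OF mv] beq_iso[OF h a] by blast
          then show ?thesis using m[OF v(1)] by auto
        qed
        then have "{v \<in> F \<alpha> a ` Md a. iso_rel `` {m v} = y} \<subseteq> range (\<lambda>b. F \<alpha> b N)" by blast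
        then show "countable {v \<in> F \<alpha> a ` Md a. iso_rel `` {m v} = y}"
          by (rule countable_subset) simp
      qed
      with big few show False unfolding num_models_def \<M>_def using ordLeq_transitive by blast
    qed
    have cls: "E \<alpha> `` {(M, a)} = {q \<in> L. F \<alpha> (snd q) (fst q) = F \<alpha> a M}" if M: "M \<in> Md a" for M a
    proof -
      have "((M, a), q) \<in> E \<alpha> \<longleftrightarrow> q \<in> L \<and> F \<alpha> (snd q) (fst q) = F \<alpha> a M" for q
        using F_iff[OF M, of "fst q" "snd q" \<alpha>] M L_iff[of "fst q" "snd q"] L_iff[of M a]
        by (auto simp: E_def)
      then show ?thesis by blast
    qed
    have "L // E \<alpha> \<subseteq> (\<Union>a. (\<lambda>v. {q \<in> L. F \<alpha> (snd q) (fst q) = v}) ` F \<alpha> a ` Md a)"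
    proof
      fix C assume "C \<in> L // E \<alpha>"
      then obtain p where p: "p \<in> L" "C = E \<alpha> `` {p}" by (rule quotientE)
      obtain M a where "p = (M, a)" by fastforce
      then show "C \<in> (\<Union>a. (\<lambda>v. {q \<in> L. F \<alpha> (snd q) (fst q) = v}) ` F \<alpha> a ` Md a)"
        using p cls L_iff by auto
    qed
    moreover have "countable (\<Union>a. (\<lambda>v. {q \<in> L. F \<alpha> (snd q) (fst q) = v}) ` F \<alpha> a ` Md a)"
      by (intro countable_UN countable_image cF) simp
    ultimately have "countable (L // E \<alpha>)" by (rule countable_subset)
    moreover have "tame {M. (M, a) \<in> C}" if C: "C \<in> L // E \<alpha>" for C a
    proof -
      obtain p where p: "p \<in> L" "C = E \<alpha> `` {p}" using C by (rule quotientE)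
      have "(M, a) \<in> C \<longleftrightarrow> M \<in> Md a \<and> (\<forall>D\<in>tests \<alpha>. (M, a) \<in> D \<longleftrightarrow> p \<in> D)" for M
        using p beq_tests[of p "(M, a)" \<alpha>] L_iff[of M a] by (auto simp: E_def)
      moreover have "tame {M. M \<in> Md a \<and> (\<forall>D\<in>tests \<alpha>. (M, a) \<in> D \<longleftrightarrow> p \<in> D)}"
        by (intro tame_conj tame_all tame_iff tame_const tt ct) (simp_all add: tame_Md)
      ultimately show ?thesis by simp
    qed
    ultimately show ?case by blast
  qed
  have "\<exists>\<epsilon>\<in>Field omega1. \<exists>\<gamma> \<delta>. stable_rank M \<gamma> \<and> \<gamma> \<sqsubset> \<delta> \<and> \<delta> \<sqsubset> \<epsilon>" for M
  proof -
    obtain \<gamma> where \<gamma>: "\<gamma> \<in> Field omega1" "stable_rank M \<gamma>" using ex_stable_rank by blast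
    obtain \<delta> where \<delta>: "\<delta> \<in> Field omega1" "\<gamma> \<sqsubset> \<delta>" using omega1_upper_bound[of "{\<gamma>}"] \<gamma>(1) by auto
    obtain \<epsilon> where "\<epsilon> \<in> Field omega1" "\<delta> \<sqsubset> \<epsilon>" using omega1_upper_bound[of "{\<delta>}"] \<delta>(1) by auto
    then show ?thesis using \<gamma>(2) \<delta>(2) by blast
  qed
  then obtain rk where rk: "\<And>M. rk M \<in> Field omega1"
    "\<And>M. \<exists>\<gamma> \<delta>. stable_rank M \<gamma> \<and> \<gamma> \<sqsubset> \<delta> \<and> \<delta> \<sqsubset> rk M" by metis
  have "\<exists>M. M \<in> \<M> \<and> x = iso_rel `` {M}" if "x \<in> \<M> // iso_rel" for x
    using that by (rule quotientE) blast
  then obtain m where m: "\<And>x. x \<in> \<M> // iso_rel \<Longrightarrow> m x \<in> \<M> \<and> x = iso_rel `` {m x}" by metis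
  \<comment> \<open>An isomorphism type is recorded by a rank two steps above a stable one and by
    the class at that rank. Equal records compare both models at the same rank, where Scott's
    argument makes them isomorphic.\<close>
  define g where "g x = (rk (m x), E (rk (m x)) `` {(m x, [])})" for x
  have mL: "(m x, []) \<in> L" if "x \<in> \<M> // iso_rel" for x using m[OF that] by (simp add: L_def)
  have "inj_on g (\<M> // iso_rel)"
  proof (rule inj_onI)
    fix x y assume xy: "x \<in> \<M> // iso_rel" "y \<in> \<M> // iso_rel" "g x = g y"
    then have rkeq: "rk (m y) = rk (m x)" and "E (rk (m x)) `` {(m x, [])} = E (rk (m x)) `` {(m y, [])}"
      by (auto simp: g_def)
    then have "((m x, []), (m y, [])) \<in> E (rk (m x))"
      using eq_equiv_class[OF _ eqv mL[OF xy(2)]] by blast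
    then have "beq (rk (m x)) (m x, []) (m y, [])" by (simp add: E_def)
    then have "m x \<cong>\<^sub>s m y" using rk(2)[of "m x"] beq_above_stable_rank_iso by blast
    then have "iso_rel `` {m x} = iso_rel `` {m y}"
      by (intro equiv_class_eq[OF equiv_iso_rel]) (simp add: iso_rel_def)
    then show "x = y" using m[OF xy(1)] m[OF xy(2)] by simp
  qed
  moreover have "g ` (\<M> // iso_rel) \<subseteq> (SIGMA \<epsilon>:Field omega1. L // E \<epsilon>)"
    unfolding g_def using quotientI[OF mL] rk(1) by (intro image_subsetI SigmaI)
  ultimately have "|\<M> // iso_rel| \<le>o |SIGMA \<epsilon>:Field omega1. L // E \<epsilon>|" using card_of_ordLeq by blast
  also have "|SIGMA \<epsilon>:Field omega1. L // E \<epsilon>| \<le>o |Field omega1|"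
  proof (rule card_of_Sigma_ordLeq_infinite[OF infinite_Field_omega1])
    show "\<forall>\<epsilon>\<in>Field omega1. |L // E \<epsilon>| \<le>o |Field omega1|"
    proof
      fix \<epsilon>
      have "|L // E \<epsilon>| \<le>o |UNIV :: nat set|"
        using main[of \<epsilon>] by (auto simp: countable_def card_of_ordLeq[symmetric])
      then show "|L // E \<epsilon>| \<le>o |Field omega1|"
        using infinite_Field_omega1 ordLeq_transitive by (auto simp: infinite_iff_card_of_nat)
    qed
  qed (rule card_of_mono1[OF subset_refl])
  also have "|Field omega1| =o omega1" by (rule card_of_Field_ordIso[OF Card_order_omega1])
  finally show "num_models T \<le>o cardSuc natLeq" unfolding num_models_def \<M>_def omega1_def .
qed

section \<open>Lexicographic sums preserve elementary equivalence\<close>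

lemma summand_unique:
  assumes "disjoint_family_on (\<lambda>i. dom_of (X i)) (dom_of I)" "i \<in> dom_of I" "j \<in> dom_of I"
    "x \<in> dom_of (X i)" "x \<in> dom_of (X j)"
  shows "i = j"
proof (rule ccontr)
  assume "i \<noteq> j"
  then have "dom_of (X i) \<inter> dom_of (X j) = {}" by (rule disjoint_family_onD[OF assms(1-3)])
  then show False using assms(4,5) by (rule disjoint_iff[THEN iffD1, rule_format, THEN notE])
qed

lemma lex_sum_le:
  assumes "disjoint_family_on (\<lambda>i. dom_of (X i)) (dom_of I)" "i \<in> dom_of I" "j \<in> dom_of I"
    "x \<in> dom_of (X i)" "y \<in> dom_of (X j)"
  shows "(x, y) \<in> le_of (lex_sum I X) \<longleftrightarrow> (if i = j then (x, y) \<in> le_of (X i) else (i, j) \<in> le_of I)"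
proof -
  have i: "k = i" if "k \<in> dom_of I" "x \<in> dom_of (X k)" for k
    using summand_unique[OF assms(1) that(1) assms(2) that(2) assms(4)] .
  have j: "k = j" if "k \<in> dom_of I" "y \<in> dom_of (X k)" for k
    using summand_unique[OF assms(1) that(1) assms(3) that(2) assms(5)] .
  have "(\<exists>k\<in>dom_of I. x \<in> dom_of (X k) \<and> y \<in> dom_of (X k) \<and> (x, y) \<in> le_of (X k)) \<longleftrightarrow>
      i = j \<and> (x, y) \<in> le_of (X i)"
    using i j assms(2-) by metis
  moreover have "(\<exists>k\<in>dom_of I. \<exists>k'\<in>dom_of I. k \<noteq> k' \<and> (k, k') \<in> le_of I \<and> x \<in> dom_of (X k) \<and> y \<in> dom_of (X k')) \<longleftrightarrow>
      i \<noteq> j \<and> (i, j) \<in> le_of I"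
    using i j assms(2-) by metis
  ultimately show ?thesis by (simp add: lex_sum_def)
qed

text \<open>The colouring \<open>c\<close> prescribes the summand of each variable. The bound on
  free variables ensures that changing \<open>x\<close> affects only the formulas tested in the
  summand of \<open>x\<close>.\<close>

definition decides ::
  "'i struct \<Rightarrow> ('i \<Rightarrow> 'a struct) \<Rightarrow> ('i \<Rightarrow> 'b struct) \<Rightarrow> fm \<Rightarrow> (nat \<Rightarrow> 'i) \<Rightarrow> ('i \<Rightarrow> fm set) \<Rightarrow> bool" where
  "decides I X Y \<phi> c F \<longleftrightarrow> (\<forall>i. finite (F i)) \<and> (\<forall>i. \<forall>\<psi>\<in>F i. fv \<psi> \<subseteq> {x \<in> fv \<phi>. c x = i}) \<and>
     (\<forall>e e'. (\<forall>x\<in>fv \<phi>. c x \<in> dom_of I \<and> e x \<in> dom_of (X (c x)) \<and> e' x \<in> dom_of (Y (c x))) \<longrightarrow>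
        (\<forall>i\<in>dom_of I. \<forall>\<psi>\<in>F i. sat (X i) e \<psi> \<longleftrightarrow> sat (Y i) e' \<psi>) \<longrightarrow>
        (sat (lex_sum I X) e \<phi> \<longleftrightarrow> sat (lex_sum I Y) e' \<phi>))"

definition type_fm :: "fm list \<Rightarrow> fm set \<Rightarrow> fm" where
  "type_fm l S = Conjs (map (\<lambda>\<psi>. if \<psi> \<in> S then \<psi> else Neg \<psi>) l)"

lemma fv_type_fm: "fv (type_fm l S) = (\<Union>\<psi>\<in>set l. fv \<psi>)"
  by (auto simp: type_fm_def fv_Conjs)

lemma sat_type_fm: "sat X e (type_fm l S) \<longleftrightarrow> (\<forall>\<psi>\<in>set l. \<psi> \<in> S \<longleftrightarrow> sat X e \<psi>)"
proof -
  have "sat X e (if \<psi> \<in> S then \<psi> else Neg \<psi>) \<longleftrightarrow> (\<psi> \<in> S \<longleftrightarrow> sat X e \<psi>)" for \<psi> by simp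
  then show ?thesis by (simp only: type_fm_def sat_Conjs set_map ball_simps)
qed

text \<open>With \<open>S\<close> the type of \<open>a\<close> over \<open>G j\<close>, the summand
  \<open>Y j\<close> realises the same type by some \<open>b\<close>. In the other summands nothing
  changes, since \<open>x\<close> is not free there.\<close>

lemma type_fm_step:
  fixes X :: "'i \<Rightarrow> 'a struct" and Y :: "'i \<Rightarrow> 'b struct"
  assumes l: "set l = G j"
    and fv: "\<And>i \<psi>. i \<noteq> j \<Longrightarrow> \<psi> \<in> G i \<Longrightarrow> x \<notin> fv \<psi>"
    and eq: "\<And>i \<psi>. i \<in> dom_of I \<Longrightarrow> i \<noteq> j \<Longrightarrow> \<psi> \<in> G i \<Longrightarrow> sat (X i) e \<psi> \<longleftrightarrow> sat (Y i) e' \<psi>"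
    and ty: "\<And>S. S \<subseteq> G j \<Longrightarrow> sat (X j) e (Ex x (type_fm l S)) \<Longrightarrow> sat (Y j) e' (Ex x (type_fm l S))"
    and a: "a \<in> dom_of (X j)"
  shows "\<exists>b\<in>dom_of (Y j). \<forall>i\<in>dom_of I. \<forall>\<psi>\<in>G i. sat (X i) (e(x := a)) \<psi> \<longleftrightarrow> sat (Y i) (e'(x := b)) \<psi>"
proof -
  define S where "S = {\<psi> \<in> G j. sat (X j) (e(x := a)) \<psi>}"
  have "sat (X j) (e(x := a)) (type_fm l S)" by (auto simp: sat_type_fm S_def l)
  then have "sat (X j) e (Ex x (type_fm l S))" using a by auto
  then have "sat (Y j) e' (Ex x (type_fm l S))" by (rule ty[rotated]) (auto simp: S_def)
  then obtain b where b: "b \<in> dom_of (Y j)" "sat (Y j) (e'(x := b)) (type_fm l S)" by auto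
  have "sat (X i) (e(x := a)) \<psi> \<longleftrightarrow> sat (Y i) (e'(x := b)) \<psi>" if i: "i \<in> dom_of I" "\<psi> \<in> G i" for i \<psi>
  proof (cases "i = j")
    case True
    then show ?thesis using b(2) i(2) by (auto simp: sat_type_fm S_def l)
  next
    case False
    then have x: "x \<notin> fv \<psi>" using fv i(2) by blast
    have "sat (X i) (e(x := a)) \<psi> \<longleftrightarrow> sat (X i) e \<psi>" "sat (Y i) (e'(x := b)) \<psi> \<longleftrightarrow> sat (Y i) e' \<psi>"
      by (rule sat_cong; use x in auto)+
    then show ?thesis using eq[OF i(1) False i(2)] by simp
  qed
  with b(1) show ?thesis by blast
qed

text \<open>
  Feferman--Vaught: once the summand of every free variable is prescribed, the truth of a formula
  in a finite sum depends on the truth of finitely many formulas in the summands. For \<open>Ex x \<phi>\<close> one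
  lets \<open>x\<close> range over each summand \<open>j\<close> and asks which complete types over the finite set of \<open>\<phi>\<close>
  are realised there.
\<close>

lemma ex_decides:
  fixes X :: "'i \<Rightarrow> 'a struct" and Y :: "'i \<Rightarrow> 'b struct"
  assumes fin: "finite (dom_of I)"
    and dX: "disjoint_family_on (\<lambda>i. dom_of (X i)) (dom_of I)"
    and dY: "disjoint_family_on (\<lambda>i. dom_of (Y i)) (dom_of I)"
  shows "\<exists>F. decides I X Y \<phi> c F"
proof (induction \<phi> arbitrary: c)
  case (Eq x y)
  show ?case
  proof (cases "c x = c y")
    case True
    then show ?thesis
      by (intro exI[of _ "\<lambda>i. if i = c x then {Eq x y} else {}"]) (simp add: decides_def)
  next
    case False
    have "sat (lex_sum I X) e (Eq x y) \<longleftrightarrow> sat (lex_sum I Y) e' (Eq x y)"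
      if e: "\<forall>x\<in>fv (Eq x y). c x \<in> dom_of I \<and> e x \<in> dom_of (X (c x)) \<and> e' x \<in> dom_of (Y (c x))" for e e'
    proof -
      have "e x \<noteq> e y" using summand_unique[OF dX, of "c x" "c y" "e x"] e False by auto
      moreover have "e' x \<noteq> e' y" using summand_unique[OF dY, of "c x" "c y" "e' x"] e False by auto
      ultimately show ?thesis by simp
    qed
    then show ?thesis unfolding decides_def by (intro exI[of _ "\<lambda>_. {}"]) simp
  qed
next
  case (Leq x y)
  show ?case
  proof (cases "c x = c y")
    case True
    then show ?thesis
      by (intro exI[of _ "\<lambda>i. if i = c x then {Leq x y} else {}"])
        (simp add: decides_def lex_sum_le[OF dX, of "c x" "c x"] lex_sum_le[OF dY, of "c x" "c x"])
  next
    \<comment> \<open>Across different summands the order is read off \<open>I\<close>, so no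
      formula has to be tested.\<close>
    case False
    then show ?thesis
      by (intro exI[of _ "\<lambda>_. {}"])
        (simp add: decides_def lex_sum_le[OF dX, of "c x" "c y"] lex_sum_le[OF dY, of "c x" "c y"])
  qed
next
  case (Neg \<phi>)
  then show ?case unfolding decides_def by simp
next
  case (Conj \<phi> \<psi>)
  obtain F where F: "decides I X Y \<phi> c F" using Conj.IH(1) by blast
  obtain G where G: "decides I X Y \<psi> c G" using Conj.IH(2) by blast
  have "decides I X Y (Conj \<phi> \<psi>) c (\<lambda>i. F i \<union> G i)"
    unfolding decides_def
  proof (intro conjI allI impI ballI)
    show "finite (F i \<union> G i)" for i using F G by (simp add: decides_def)
    show "fv \<theta> \<subseteq> {x \<in> fv (Conj \<phi> \<psi>). c x = i}" if "\<theta> \<in> F i \<union> G i" for i \<theta>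
    proof -
      have "fv \<theta> \<subseteq> {x \<in> fv \<phi>. c x = i} \<or> fv \<theta> \<subseteq> {x \<in> fv \<psi>. c x = i}"
        using that F G unfolding decides_def by blast
      then show ?thesis by auto
    qed
    show "sat (lex_sum I X) e (Conj \<phi> \<psi>) \<longleftrightarrow> sat (lex_sum I Y) e' (Conj \<phi> \<psi>)"
      if e: "\<forall>x\<in>fv (Conj \<phi> \<psi>). c x \<in> dom_of I \<and> e x \<in> dom_of (X (c x)) \<and> e' x \<in> dom_of (Y (c x))"
        "\<forall>i\<in>dom_of I. \<forall>\<theta>\<in>F i \<union> G i. sat (X i) e \<theta> \<longleftrightarrow> sat (Y i) e' \<theta>" for e e'
    proof -
      have "sat (lex_sum I X) e \<phi> \<longleftrightarrow> sat (lex_sum I Y) e' \<phi>" using F e unfolding decides_def by simp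
      moreover have "sat (lex_sum I X) e \<psi> \<longleftrightarrow> sat (lex_sum I Y) e' \<psi>" using G e unfolding decides_def by simp
      ultimately show ?thesis by simp
    qed
  qed
  then show ?case by blast
next
  case (Ex x \<phi>)
  have "\<forall>j. \<exists>F. decides I X Y \<phi> (c(x := j)) F" using Ex.IH by blast
  then obtain G where G: "\<And>j. decides I X Y \<phi> (c(x := j)) (G j)" by metis
  have finG: "finite (G j i)" for i j using G[of j] by (simp add: decides_def)
  have fvG: "fv \<psi> \<subseteq> {y \<in> fv \<phi>. (c(x := j)) y = i}" if "\<psi> \<in> G j i" for i j \<psi>
    using G[of j] that unfolding decides_def by blast
  have "\<forall>j. \<exists>l. set l = G j j" using finG finite_list by blast
  then obtain l where l: "\<And>j. set (l j) = G j j" by metis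
  \<comment> \<open>For \<open>x\<close> in another summand \<open>j\<close>, the formulas
    \<open>G j i\<close> do not mention \<open>x\<close> and are kept. For \<open>x\<close> in the
    summand \<open>i\<close> itself they are replaced by the statements that a type over them is
    realised.\<close>
  define F where "F i = (\<Union>j\<in>dom_of I - {i}. G j i) \<union> (\<lambda>S. Ex x (type_fm (l i) S)) ` Pow (G i i)" for i
  have "decides I X Y (Ex x \<phi>) c F"
    unfolding decides_def
  proof (intro conjI allI impI ballI)
    show "finite (F i)" for i using fin finG by (simp add: F_def)
    show "fv \<theta> \<subseteq> {y \<in> fv (Ex x \<phi>). c y = i}" if "\<theta> \<in> F i" for i \<theta>
    proof (cases "\<exists>j\<in>dom_of I - {i}. \<theta> \<in> G j i")
      case True
      then obtain j where "j \<noteq> i" "\<theta> \<in> G j i" by blast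
      then show ?thesis using fvG[of \<theta> j i] by (auto split: if_splits)
    next
      case False
      then obtain S where "\<theta> = Ex x (type_fm (l i) S)" using \<open>\<theta> \<in> F i\<close> by (auto simp: F_def)
      then show ?thesis using fvG[of _ i i] by (fastforce simp: fv_type_fm l split: if_splits)
    qed
    fix e e'
    assume dom: "\<forall>y\<in>fv (Ex x \<phi>). c y \<in> dom_of I \<and> e y \<in> dom_of (X (c y)) \<and> e' y \<in> dom_of (Y (c y))"
      and F: "\<forall>i\<in>dom_of I. \<forall>\<psi>\<in>F i. sat (X i) e \<psi> \<longleftrightarrow> sat (Y i) e' \<psi>"
    have notin: "x \<notin> fv \<psi>" if "i \<noteq> j" "\<psi> \<in> G j i" for i j \<psi>
      using fvG[OF that(2)] that(1) by auto
    have eq: "sat (X i) e \<psi> \<longleftrightarrow> sat (Y i) e' \<psi>" if "i \<in> dom_of I" "j \<in> dom_of I" "i \<noteq> j" "\<psi> \<in> G j i" for i j \<psi>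
    proof -
      have "\<psi> \<in> F i" using that by (auto simp: F_def)
      then show ?thesis using F that(1) by blast
    qed
    have ty: "sat (X j) e (Ex x (type_fm (l j) S)) \<longleftrightarrow> sat (Y j) e' (Ex x (type_fm (l j) S))"
      if "j \<in> dom_of I" "S \<subseteq> G j j" for j S
    proof -
      have "Ex x (type_fm (l j) S) \<in> F j" using that by (auto simp: F_def)
      then show ?thesis using F that(1) by blast
    qed
    have IH: "sat (lex_sum I X) (e(x := a)) \<phi> \<longleftrightarrow> sat (lex_sum I Y) (e'(x := b)) \<phi>"
      if "j \<in> dom_of I" "a \<in> dom_of (X j)" "b \<in> dom_of (Y j)"
        "\<forall>i\<in>dom_of I. \<forall>\<psi>\<in>G j i. sat (X i) (e(x := a)) \<psi> \<longleftrightarrow> sat (Y i) (e'(x := b)) \<psi>" for j a b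
    proof -
      have "\<forall>y\<in>fv \<phi>. (c(x := j)) y \<in> dom_of I \<and> (e(x := a)) y \<in> dom_of (X ((c(x := j)) y)) \<and>
          (e'(x := b)) y \<in> dom_of (Y ((c(x := j)) y))"
        using dom that(1-3) by auto
      then show ?thesis using G[of j] that(4) unfolding decides_def by blast
    qed
    show "sat (lex_sum I X) e (Ex x \<phi>) \<longleftrightarrow> sat (lex_sum I Y) e' (Ex x \<phi>)"
    proof
      assume "sat (lex_sum I X) e (Ex x \<phi>)"
      then obtain j a where a: "j \<in> dom_of I" "a \<in> dom_of (X j)" "sat (lex_sum I X) (e(x := a)) \<phi>"
        by (auto simp: lex_sum_def)
      have "\<exists>b\<in>dom_of (Y j). \<forall>i\<in>dom_of I. \<forall>\<psi>\<in>G j i. sat (X i) (e(x := a)) \<psi> \<longleftrightarrow> sat (Y i) (e'(x := b)) \<psi>"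
      proof (rule type_fm_step[of "l j" "G j" j, OF l])
        show "x \<notin> fv \<psi>" if "i \<noteq> j" "\<psi> \<in> G j i" for i \<psi> using that by (rule notin)
        show "sat (X i) e \<psi> \<longleftrightarrow> sat (Y i) e' \<psi>" if "i \<in> dom_of I" "i \<noteq> j" "\<psi> \<in> G j i" for i \<psi>
          by (rule eq[OF that(1) a(1) that(2,3)])
        show "sat (Y j) e' (Ex x (type_fm (l j) S))" if "S \<subseteq> G j j" "sat (X j) e (Ex x (type_fm (l j) S))" for S
          using ty[OF a(1) that(1)] that(2) by (rule iffD1)
      qed (rule a(2))
      then obtain b where "b \<in> dom_of (Y j)" "sat (lex_sum I Y) (e'(x := b)) \<phi>" using IH a by blast
      then show "sat (lex_sum I Y) e' (Ex x \<phi>)" using a(1) by (auto simp: lex_sum_def)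
    next
      assume "sat (lex_sum I Y) e' (Ex x \<phi>)"
      then obtain j b where b: "j \<in> dom_of I" "b \<in> dom_of (Y j)" "sat (lex_sum I Y) (e'(x := b)) \<phi>"
        by (auto simp: lex_sum_def)
      have "\<exists>a\<in>dom_of (X j). \<forall>i\<in>dom_of I. \<forall>\<psi>\<in>G j i. sat (Y i) (e'(x := b)) \<psi> \<longleftrightarrow> sat (X i) (e(x := a)) \<psi>"
      proof (rule type_fm_step[of "l j" "G j" j, OF l])
        show "x \<notin> fv \<psi>" if "i \<noteq> j" "\<psi> \<in> G j i" for i \<psi> using that by (rule notin)
        show "sat (Y i) e' \<psi> \<longleftrightarrow> sat (X i) e \<psi>" if "i \<in> dom_of I" "i \<noteq> j" "\<psi> \<in> G j i" for i \<psi>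
          by (rule eq[OF that(1) b(1) that(2,3), symmetric])
        show "sat (X j) e (Ex x (type_fm (l j) S))" if "S \<subseteq> G j j" "sat (Y j) e' (Ex x (type_fm (l j) S))" for S
          using ty[OF b(1) that(1)] that(2) by (rule iffD2)
      qed (rule b(2))
      then obtain a where "a \<in> dom_of (X j)" "sat (lex_sum I X) (e(x := a)) \<phi>" using IH b by metis
      then show "sat (lex_sum I X) e (Ex x \<phi>)" using b(1) by (auto simp: lex_sum_def)
    qed
  qed
  then show ?case by blast
qed

text \<open>The assignment may leave the domain. This is needed for sums, where one constant
  assignment is used in all summands although its value lies in only one.\<close>

lemma sat_sentence:
  assumes "\<psi> \<in> sentences" "is_struct Z"
  shows "sat Z e \<psi> \<longleftrightarrow> holds Z \<psi>"
proof -
  obtain z where "z \<in> dom_of Z" using assms(2) by (auto simp: is_struct_def)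
  then have "holds Z \<psi> \<longleftrightarrow> sat Z (\<lambda>_. z) \<psi>" using assms(1) by (intro holds_sentence) auto
  also have "\<dots> \<longleftrightarrow> sat Z e \<psi>" using assms(1) by (intro sat_cong) (simp add: sentences_def)
  finally show ?thesis ..
qed

text \<open>A sentence has no free variables, so the formulas that decide it are sentences too, and
  the summands agree on them by assumption.\<close>

lemma lex_sum_elementarily_equivalent:
  fixes X :: "'i \<Rightarrow> 'a struct" and Y :: "'i \<Rightarrow> 'b struct"
  assumes fin: "finite (dom_of I)" and ne: "dom_of I \<noteq> {}"
    and dX: "disjoint_family_on (\<lambda>i. dom_of (X i)) (dom_of I)"
    and dY: "disjoint_family_on (\<lambda>i. dom_of (Y i)) (dom_of I)"
    and X: "\<And>i. i \<in> dom_of I \<Longrightarrow> is_struct (X i)" and Y: "\<And>i. i \<in> dom_of I \<Longrightarrow> is_struct (Y i)"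
    and eq: "\<And>i \<psi>. i \<in> dom_of I \<Longrightarrow> \<psi> \<in> sentences \<Longrightarrow> holds (X i) \<psi> \<longleftrightarrow> holds (Y i) \<psi>"
    and \<phi>: "\<phi> \<in> sentences"
  shows "holds (lex_sum I X) \<phi> \<longleftrightarrow> holds (lex_sum I Y) \<phi>"
proof -
  obtain i where i: "i \<in> dom_of I" using ne by blast
  obtain a b where a: "a \<in> dom_of (X i)" and b: "b \<in> dom_of (Y i)"
    using X[OF i] Y[OF i] by (auto simp: is_struct_def)
  obtain F where F: "decides I X Y \<phi> (\<lambda>_. i) F" using ex_decides[OF fin dX dY] by blast
  have sent: "\<psi> \<in> sentences" if "\<psi> \<in> F j" for j \<psi>
    using F that \<phi> unfolding decides_def sentences_def by blast
  have "sat (X j) (\<lambda>_. a) \<psi> \<longleftrightarrow> sat (Y j) (\<lambda>_. b) \<psi>" if "j \<in> dom_of I" "\<psi> \<in> F j" for j \<psi>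
    using sat_sentence[OF sent X] sat_sentence[OF sent Y] eq[OF that(1) sent] that by blast
  then have "sat (lex_sum I X) (\<lambda>_. a) \<phi> \<longleftrightarrow> sat (lex_sum I Y) (\<lambda>_. b) \<phi>"
    using F \<phi> unfolding decides_def sentences_def by simp
  moreover have "holds (lex_sum I X) \<phi> \<longleftrightarrow> sat (lex_sum I X) (\<lambda>_. a) \<phi>"
    using a i by (intro holds_sentence \<phi>) (auto simp: lex_sum_def)
  moreover have "holds (lex_sum I Y) \<phi> \<longleftrightarrow> sat (lex_sum I Y) (\<lambda>_. b) \<phi>"
    using b i by (intro holds_sentence \<phi>) (auto simp: lex_sum_def)
  ultimately show ?thesis by simp
qed

section \<open>Decompositions of a countable structure\<close>

lemma is_iso_inv_into:
  assumes "is_iso X Y f"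
  shows "is_iso Y X (inv_into (dom_of X) f)"
proof -
  have f: "bij_betw f (dom_of X) (dom_of Y)"
    and r: "\<forall>x\<in>dom_of X. \<forall>y\<in>dom_of X. (x, y) \<in> le_of X \<longleftrightarrow> (f x, f y) \<in> le_of Y"
    using assms by (auto simp: is_iso_def)
  show ?thesis
    unfolding is_iso_def
    using r bij_betw_inv_into[OF f] bij_betw_inv_into_right[OF f] bij_betwE[OF bij_betw_inv_into[OF f]]
    by auto
qed

lemma is_iso_comp: "is_iso X Y f \<Longrightarrow> is_iso Y Z g \<Longrightarrow> is_iso X Z (g \<circ> f)"
  unfolding is_iso_def by (auto intro: bij_betw_trans dest: bij_betwE)

definition largest :: "'a struct \<Rightarrow> 'a \<Rightarrow> bool" where
  "largest X m \<longleftrightarrow> m \<in> dom_of X \<and> (\<forall>x\<in>dom_of X. (x, m) \<in> le_of X)"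

text \<open>For \<open>x\<close> in the summand \<open>k\<close>, being below \<open>m j\<close> in
  the sum means \<open>k\<close> below \<open>j\<close> in \<open>I\<close>. So \<open>k\<close> is
  the least such index, and antisymmetry identifies it with \<open>i\<close>.\<close>

lemma summand_iff_largest:
  assumes d: "FLD1_decomp I X" and m: "\<And>j. j \<in> dom_of I \<Longrightarrow> largest (X j) (m j)"
    and i: "i \<in> dom_of I" and x: "x \<in> dom_of (lex_sum I X)"
  shows "x \<in> dom_of (X i) \<longleftrightarrow>
    (x, m i) \<in> le_of (lex_sum I X) \<and> (\<forall>j\<in>dom_of I. (x, m j) \<in> le_of (lex_sum I X) \<longrightarrow> (i, j) \<in> le_of I)"
proof -
  have dj: "disjoint_family_on (\<lambda>i. dom_of (X i)) (dom_of I)" and po: "is_po I"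
    using d by (auto simp: FLD1_decomp_def)
  have re: "(j, j) \<in> le_of I" if "j \<in> dom_of I" for j
    using po that by (auto simp: is_po_def partial_order_on_def preorder_on_def refl_on_def)
  have an: "antisym (le_of I)" using po by (auto simp: is_po_def partial_order_on_def)
  obtain k where k: "k \<in> dom_of I" "x \<in> dom_of (X k)" using x by (auto simp: lex_sum_def)
  have le: "(x, m j) \<in> le_of (lex_sum I X) \<longleftrightarrow> (k, j) \<in> le_of I" if "j \<in> dom_of I" for j
    using lex_sum_le[OF dj k(1) that k(2), of "m j"] m[OF that] k re[OF that]
    by (auto simp: largest_def)
  show ?thesis
  proof
    assume "x \<in> dom_of (X i)"
    then have "k = i" using summand_unique[OF dj k(1) i k(2)] by blast
    then show "(x, m i) \<in> le_of (lex_sum I X) \<and> (\<forall>j\<in>dom_of I. (x, m j) \<in> le_of (lex_sum I X) \<longrightarrow> (i, j) \<in> le_of I)"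
      using le re i by blast
  next
    assume *: "(x, m i) \<in> le_of (lex_sum I X) \<and> (\<forall>j\<in>dom_of I. (x, m j) \<in> le_of (lex_sum I X) \<longrightarrow> (i, j) \<in> le_of I)"
    then have "(k, i) \<in> le_of I" using le i by blast
    moreover have "(i, k) \<in> le_of I" using * le k(1) re by blast
    ultimately have "k = i" using an by (auto dest: antisymD)
    then show "x \<in> dom_of (X i)" using k(2) by simp
  qed
qed

text \<open>An isomorphism that matches the largest elements preserves the description in
  \<open>summand_iff_largest\<close>, so it maps each summand onto the one with the same
  index.\<close>

lemma summands_isomorphic:
  assumes dX: "FLD1_decomp I X" and dY: "FLD1_decomp I Y"
    and mX: "\<And>j. j \<in> dom_of I \<Longrightarrow> largest (X j) (m j)"
    and mY: "\<And>j. j \<in> dom_of I \<Longrightarrow> largest (Y j) (n j)"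
    and g: "is_iso (lex_sum I X) (lex_sum I Y) g"
    and gm: "\<And>j. j \<in> dom_of I \<Longrightarrow> g (m j) = n j"
    and i: "i \<in> dom_of I"
  shows "X i \<cong>\<^sub>s Y i"
proof -
  let ?A = "lex_sum I X" and ?B = "lex_sum I Y"
  have bij: "bij_betw g (dom_of ?A) (dom_of ?B)"
    and le: "\<And>x y. x \<in> dom_of ?A \<Longrightarrow> y \<in> dom_of ?A \<Longrightarrow> (x, y) \<in> le_of ?A \<longleftrightarrow> (g x, g y) \<in> le_of ?B"
    using g by (auto simp: is_iso_def)
  have subX: "dom_of (X i) \<subseteq> dom_of ?A" and subY: "dom_of (Y i) \<subseteq> dom_of ?B"
    using i by (auto simp: lex_sum_def)
  have m: "m j \<in> dom_of ?A" if "j \<in> dom_of I" for j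
    using mX[OF that] that by (auto simp: lex_sum_def largest_def)
  have comp: "x \<in> dom_of (X i) \<longleftrightarrow> g x \<in> dom_of (Y i)" if x: "x \<in> dom_of ?A" for x
  proof -
    have gx: "g x \<in> dom_of ?B" using bij x by (auto simp: bij_betw_def)
    have "(x, m j) \<in> le_of ?A \<longleftrightarrow> (g x, n j) \<in> le_of ?B" if "j \<in> dom_of I" for j
      using le[OF x m[OF that]] gm[OF that] by simp
    then show ?thesis
      using summand_iff_largest[OF dX mX i x] summand_iff_largest[OF dY mY i gx] i by blast
  qed
  have "inj_on g (dom_of (X i))" using bij subX by (auto simp: bij_betw_def intro: inj_on_subset)
  moreover have "g ` dom_of (X i) = dom_of (Y i)"
  proof
    show "g ` dom_of (X i) \<subseteq> dom_of (Y i)" using comp subX by blast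
    show "dom_of (Y i) \<subseteq> g ` dom_of (X i)"
    proof
      fix y assume y: "y \<in> dom_of (Y i)"
      then obtain x where x: "x \<in> dom_of ?A" "y = g x" using subY bij by (auto simp: bij_betw_def)
      then show "y \<in> g ` dom_of (X i)" using comp y by blast
    qed
  qed
  moreover have "(x, y) \<in> le_of (X i) \<longleftrightarrow> (g x, g y) \<in> le_of (Y i)"
    if xy: "x \<in> dom_of (X i)" "y \<in> dom_of (X i)" for x y
  proof -
    have "g x \<in> dom_of (Y i)" "g y \<in> dom_of (Y i)" using comp xy subX by blast+
    moreover have "disjoint_family_on (\<lambda>i. dom_of (X i)) (dom_of I)" "disjoint_family_on (\<lambda>i. dom_of (Y i)) (dom_of I)"
      using dX dY by (auto simp: FLD1_decomp_def)
    ultimately show ?thesis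
      using le[of x y] xy subX lex_sum_le[OF _ i i, of X x y] lex_sum_le[OF _ i i, of Y "g x" "g y"] by auto
  qed
  ultimately have "is_iso (X i) (Y i) g" by (auto simp: is_iso_def bij_betw_def)
  then show ?thesis by (auto simp: isomorphic_def)
qed

text \<open>Having a largest element is first-order, so elementarily equivalent summands inherit it
  and again form a decomposition.\<close>

lemma holds_has_largest:
  assumes "is_struct X"
  shows "holds X (Ex 0 (All 1 (Leq 1 0))) \<longleftrightarrow> has_largest X"
proof -
  obtain a where "a \<in> dom_of X" using assms by (auto simp: is_struct_def)
  then have "holds X (Ex 0 (All 1 (Leq 1 0))) \<longleftrightarrow> sat X (\<lambda>_. a) (Ex 0 (All 1 (Leq 1 0)))"
    by (intro holds_sentence) (auto simp: sentences_def)
  then show ?thesis by (simp add: has_largest_def)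
qed

lemma model_of_Th_iff:
  assumes X: "is_struct X" and Y: "is_model Y (Th X)" and \<phi>: "\<phi> \<in> sentences"
  shows "holds Y \<phi> \<longleftrightarrow> holds X \<phi>"
proof (cases "holds X \<phi>")
  case True
  then show ?thesis using Y \<phi> by (auto simp: is_model_def Th_def)
next
  case False
  have n: "Neg \<phi> \<in> sentences" using \<phi> by (simp add: sentences_def)
  have "holds X (Neg \<phi>)" using False holds_Neg[OF \<phi> X] by simp
  then have "holds Y (Neg \<phi>)" using Y n by (auto simp: is_model_def Th_def)
  then show ?thesis using False holds_Neg[OF \<phi>, of Y] Y by (simp add: is_model_def)
qed

section \<open>Counting the models of a sum\<close>

abbreviation iso_types :: "fm set \<Rightarrow> nat struct set set" where
  "iso_types T \<equiv> {M. is_model M T} // iso_rel"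

lemma product_iso_types_le:
  fixes I :: "'i struct" and X :: "'i \<Rightarrow> 'a struct"
  assumes dX: "FLD1_decomp I X" and TX: "is_model (lex_sum I X) T" and T: "T \<subseteq> sentences"
    and unc: "uncountable (\<Pi>\<^sub>E i\<in>dom_of I. iso_types (Th (X i)))"
  shows "|\<Pi>\<^sub>E i\<in>dom_of I. iso_types (Th (X i))| \<le>o |iso_types T|"
proof -
  let ?P = "\<Pi>\<^sub>E i\<in>dom_of I. iso_types (Th (X i))"
  have fin: "finite (dom_of I)" and po: "is_po I" and djX: "disjoint_family_on (\<lambda>i. dom_of (X i)) (dom_of I)"
    using dX by (auto simp: FLD1_decomp_def)
  have ne: "dom_of I \<noteq> {}" using TX by (auto simp: is_model_def is_struct_def lex_sum_def)
  have Xpo: "is_po (X i)" and Xl: "has_largest (X i)" if "i \<in> dom_of I" for i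
    using dX that by (auto simp: FLD1_decomp_def)
  have Xs: "is_struct (X i)" if "i \<in> dom_of I" for i
    using Xpo[OF that] Xl[OF that]
    by (auto simp: is_struct_def has_largest_def is_po_def partial_order_on_def preorder_on_def)
  have "\<exists>M. is_model M (Th (X i)) \<and> s i = iso_rel `` {M}" if "s \<in> ?P" "i \<in> dom_of I" for s i
  proof -
    have "s i \<in> iso_types (Th (X i))" using that by (auto simp: PiE_iff)
    then show ?thesis by (rule quotientE) blast
  qed
  then obtain R where R: "\<And>s i. s \<in> ?P \<Longrightarrow> i \<in> dom_of I \<Longrightarrow> is_model (R s i) (Th (X i)) \<and> s i = iso_rel `` {R s i}"
    by metis
  \<comment> \<open>Tagging the elements with a number for the index \<open>i\<close> makes the
    chosen representatives disjoint within \<open>nat\<close>.\<close>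
  define shift where "shift i n = prod_encode (to_nat_on (dom_of I) i, n)" for i n
  define Y where "Y s i = image_struct (shift i) (R s i)" for s i
  have inj: "inj_on (shift i) S" for i S by (auto simp: inj_on_def shift_def)
  have Rs: "is_struct (R s i)" if "s \<in> ?P" "i \<in> dom_of I" for s i
    using R[OF that] by (simp add: is_model_def)
  have Yiso: "is_iso (R s i) (Y s i) (shift i)" if "s \<in> ?P" "i \<in> dom_of I" for s i
    unfolding Y_def by (rule image_struct_iso[OF inj Rs[OF that]])
  have Ys: "is_struct (Y s i)" if "s \<in> ?P" "i \<in> dom_of I" for s i
    unfolding Y_def by (rule image_struct_is_struct[OF Rs[OF that]])
  have Yeq: "holds (X i) \<phi> \<longleftrightarrow> holds (Y s i) \<phi>" if "s \<in> ?P" "i \<in> dom_of I" "\<phi> \<in> sentences" for s i \<phi>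
    using model_of_Th_iff[OF Xs[OF that(2)], of "R s i" \<phi>] holds_iso[OF Yiso[OF that(1,2)] that(3) Rs[OF that(1,2)]]
      R[OF that(1,2)] that(3) by blast
  have Ypo: "is_po (Y s i)" if "s \<in> ?P" "i \<in> dom_of I" for s i
    using Xpo[OF that(2)] holds_po_axioms[OF Xs[OF that(2)]] holds_po_axioms[OF Ys[OF that]]
      Yeq[OF that] po_axioms_sentences by blast
  have Yl: "has_largest (Y s i)" if "s \<in> ?P" "i \<in> dom_of I" for s i
    using Xl[OF that(2)] holds_has_largest[OF Xs[OF that(2)]] holds_has_largest[OF Ys[OF that]]
      Yeq[OF that, of "Ex 0 (All 1 (Leq 1 0))"] by (simp add: sentences_def)
  have djY: "disjoint_family_on (\<lambda>i. dom_of (Y s i)) (dom_of I)" for s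
  proof -
    have "inj_on (to_nat_on (dom_of I)) (dom_of I)" using fin by (intro inj_on_to_nat_on countable_finite)
    then show ?thesis
      unfolding disjoint_family_on_def Y_def image_struct_def shift_def by (auto dest: inj_onD)
  qed
  have dY: "FLD1_decomp I (Y s)" if "s \<in> ?P" for s
    using fin po Ypo[OF that] Yl[OF that] djY by (auto simp: FLD1_decomp_def)
  have model: "is_model (lex_sum I (Y s)) T" if s: "s \<in> ?P" for s
  proof -
    have "holds (lex_sum I (Y s)) \<phi>" if "\<phi> \<in> T" for \<phi>
    proof -
      have "holds (lex_sum I X) \<phi> \<longleftrightarrow> holds (lex_sum I (Y s)) \<phi>"
        by (rule lex_sum_elementarily_equivalent[OF fin ne djX djY Xs Ys[OF s] Yeq[OF s]]) (use that T in auto)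
      then show ?thesis using TX that by (auto simp: is_model_def)
    qed
    moreover have "is_struct (lex_sum I (Y s))"
      using Ys[OF s] ne unfolding is_struct_def by (auto simp: lex_sum_def)
    ultimately show ?thesis by (simp add: is_model_def)
  qed
  have "\<exists>m. largest (Y s i) m" if "s \<in> ?P" "i \<in> dom_of I" for s i
    using Yl[OF that] by (auto simp: has_largest_def largest_def)
  then obtain m where m: "\<And>s i. s \<in> ?P \<Longrightarrow> i \<in> dom_of I \<Longrightarrow> largest (Y s i) (m s i)" by metis
  show ?thesis
  proof (rule ordLeq_countable_fibres[where f = "\<lambda>s. iso_rel `` {lex_sum I (Y s)}", OF _ _ unc])
    show "(\<lambda>s. iso_rel `` {lex_sum I (Y s)}) ` ?P \<subseteq> iso_types T"
      by (intro image_subsetI quotientI CollectI model)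
    fix y assume "y \<in> iso_types T"
    then obtain W where W: "y = iso_rel `` {W}" by (rule quotientE)
    let ?S = "{s \<in> ?P. iso_rel `` {lex_sum I (Y s)} = y}"
    define f where "f s = (SOME f. is_iso (lex_sum I (Y s)) W f)" for s
    have f: "is_iso (lex_sum I (Y s)) W (f s)" if "s \<in> ?S" for s
    proof -
      have "iso_rel `` {lex_sum I (Y s)} = iso_rel `` {W}" using that W by simp
      then have "(lex_sum I (Y s), W) \<in> iso_rel" by (rule eq_equiv_class[OF _ equiv_iso_rel UNIV_I])
      then have "\<exists>f. is_iso (lex_sum I (Y s)) W f" by (simp add: iso_rel_def isomorphic_def)
      then show ?thesis unfolding f_def by (rule someI_ex[of "is_iso (lex_sum I (Y s)) W"])
    qed
    \<comment> \<open>Within one fibre, all sums are mapped onto the same \<open>W\<close>. The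
      finite tuple of places in \<open>W\<close> where the largest elements arrive determines every
      summand up to isomorphism, hence \<open>s\<close>; there are only countably many such
      tuples.\<close>
    define code where "code s = restrict (\<lambda>i. f s (m s i)) (dom_of I)" for s
    have "inj_on code ?S"
    proof (rule inj_onI)
      fix s t assume st: "s \<in> ?S" "t \<in> ?S" "code s = code t"
      have sP: "s \<in> ?P" and tP: "t \<in> ?P" using st by auto
      let ?B = "lex_sum I (Y t)"
      define g where "g = inv_into (dom_of ?B) (f t) \<circ> f s"
      have g: "is_iso (lex_sum I (Y s)) ?B g"
        unfolding g_def by (rule is_iso_comp[OF f[OF st(1)] is_iso_inv_into[OF f[OF st(2)]]])
      have gm: "g (m s i) = m t i" if "i \<in> dom_of I" for i
      proof -
        have "f s (m s i) = f t (m t i)" using fun_cong[OF st(3), of i] that by (simp add: code_def)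
        moreover have "m t i \<in> dom_of ?B" using m[OF tP that] that by (auto simp: largest_def lex_sum_def)
        moreover have "inj_on (f t) (dom_of ?B)" using f[OF st(2)] by (auto simp: is_iso_def bij_betw_def)
        ultimately show ?thesis by (simp add: g_def)
      qed
      have "s i = t i" if i: "i \<in> dom_of I" for i
      proof -
        have "Y s i \<cong>\<^sub>s Y t i"
          by (rule summands_isomorphic[OF dY[OF sP] dY[OF tP] m[OF sP] m[OF tP] g gm i])
        moreover have "R s i \<cong>\<^sub>s Y s i" "R t i \<cong>\<^sub>s Y t i"
          using Yiso[OF sP i] Yiso[OF tP i] by (auto simp: isomorphic_def)
        ultimately have "(R s i, R t i) \<in> iso_rel"
          unfolding iso_rel_def using isomorphic_sym isomorphic_trans by blast
        then show ?thesis using R[OF sP i] R[OF tP i] equiv_class_eq[OF equiv_iso_rel] by simp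
      qed
      then show "s = t" using sP tP by (intro PiE_ext)
    qed
    moreover have "countable (code ` ?S)"
    proof (rule countable_subset)
      show "code ` ?S \<subseteq> (\<Pi>\<^sub>E i\<in>dom_of I. UNIV :: nat set)" by (auto simp: code_def)
      show "countable (\<Pi>\<^sub>E i\<in>dom_of I. UNIV :: nat set)" using fin by (intro countable_PiE) auto
    qed
    ultimately show "countable ?S" by (rule countable_image_inj_on[rotated])
  qed
qed

section \<open>Cardinal bounds for finite products and for the set of isomorphism types\<close>

lemma card_of_PiE_le:
  assumes "finite J" "infinite B" "\<And>i. i \<in> J \<Longrightarrow> |A i| \<le>o |B|"
  shows "|Pi\<^sub>E J A| \<le>o |B|"
  using assms(1,3)
proof (induction J)
  case empty
  have "|{\<lambda>_. undefined} :: ('a \<Rightarrow> 'c) set| \<le>o |B|"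
    using assms(2) by (intro card_of_singl_ordLeq) auto
  then show ?case by simp
next
  case (insert x J)
  have "|Pi\<^sub>E (insert x J) A| \<le>o |A x \<times> Pi\<^sub>E J A|"
    unfolding PiE_insert_eq by (rule card_of_image)
  also have "|A x \<times> Pi\<^sub>E J A| \<le>o |B|"
    using insert assms(2) by (intro card_of_Times_ordLeq_infinite_Field card_of_Card_order) (auto simp: Field_card_of)
  finally show ?case .
qed

text \<open>Evaluation at \<open>i\<close> maps onto \<open>A i\<close>, because the other factors
  are nonempty and any value at \<open>i\<close> can be completed.\<close>

lemma card_of_component_le_PiE:
  assumes "i \<in> J" "\<And>j. j \<in> J \<Longrightarrow> A j \<noteq> {}"
  shows "|A i| \<le>o |Pi\<^sub>E J A|"
proof -
  have "A i \<subseteq> (\<lambda>f. f i) ` Pi\<^sub>E J A"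
  proof
    fix x assume "x \<in> A i"
    then have "restrict (\<lambda>j. if j = i then x else SOME y. y \<in> A j) J \<in> Pi\<^sub>E J A"
      using assms(2) by (auto simp: some_in_eq)
    then show "x \<in> (\<lambda>f. f i) ` Pi\<^sub>E J A" by (rule image_eqI[rotated]) (simp add: assms(1))
  qed
  then have "|A i| \<le>o |(\<lambda>f. f i) ` Pi\<^sub>E J A|" by (rule card_of_mono1)
  then show ?thesis using card_of_image ordLeq_transitive by blast
qed

lemma iso_types_le_continuum: "|iso_types T| \<le>o |UNIV :: (nat \<Rightarrow> bool) set|"
proof -
  have "iso_types T = (\<lambda>M. iso_rel `` {M}) ` {M. is_model M T}"
    unfolding quotient_def by blast
  then have "|iso_types T| \<le>o |{M :: nat struct. is_model M T}|"
    using card_of_image[of "\<lambda>M. iso_rel `` {M}" "{M. is_model M T}"] by simp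
  also have "|{M :: nat struct. is_model M T}| \<le>o |UNIV :: nat struct set|"
    by (rule card_of_mono1[OF subset_UNIV])
  also have "|UNIV :: nat struct set| \<le>o |UNIV :: (nat \<Rightarrow> bool) set|"
  proof -
    \<comment> \<open>One 0-1 sequence holds both parts of a structure: first component 0 marks the
      entries for the domain, a positive one those for the relation.\<close>
    let ?g = "\<lambda>(A, R) k. case prod_decode k of (0, n) \<Rightarrow> n \<in> A | (Suc _, n) \<Rightarrow> prod_decode n \<in> R"
    have "inj ?g"
    proof (rule injI, clarify)
      fix A A' :: "nat set" and R R' :: "nat rel"
      assume eq: "(\<lambda>k. case prod_decode k of (0, n) \<Rightarrow> n \<in> A | (Suc _, n) \<Rightarrow> prod_decode n \<in> R) =
        (\<lambda>k. case prod_decode k of (0, n) \<Rightarrow> n \<in> A' | (Suc _, n) \<Rightarrow> prod_decode n \<in> R')"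
      have "n \<in> A \<longleftrightarrow> n \<in> A'" for n using fun_cong[OF eq, of "prod_encode (0, n)"] by simp
      moreover have "p \<in> R \<longleftrightarrow> p \<in> R'" for p
        using fun_cong[OF eq, of "prod_encode (1, prod_encode p)"] by simp
      ultimately show "A = A' \<and> R = R'" by blast
    qed
    then show ?thesis using card_of_ordLeq by blast
  qed
  finally show ?thesis .
qed

lemma continuum_eq: "ctwo ^c natLeq = |UNIV :: (nat \<Rightarrow> bool) set|"
  by (simp add: cexp_def ctwo_def Field_card_of Field_natLeq Func_def)

theorem theorem3p4:
  fixes T :: "fm set" and I :: "'i struct" and X :: "'i \<Rightarrow> 'a struct"
  assumes "FLD1_theory T"
    and "(I, X) \<in> FLD1_decomps T"
    and "\<exists>i\<in>dom_of I. natLeq <o num_models_of (X i)"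
  shows "Cprod (dom_of I) (\<lambda>i. num_models_of (X i)) \<le>o num_models T \<and>
    (Cprod (dom_of I) (\<lambda>i. num_models_of (X i)) =o cardSuc natLeq \<or>
     Cprod (dom_of I) (\<lambda>i. num_models_of (X i)) =o ctwo ^c natLeq)"
proof -
  let ?Q = "\<lambda>i. iso_types (Th (X i))"
  let ?P = "\<Pi>\<^sub>E i\<in>dom_of I. ?Q i"
  have d: "FLD1_decomp I X" and M: "is_model (lex_sum I X) T" using assms(2) by (auto simp: FLD1_decomps_def)
  have T: "T \<subseteq> sentences" using assms(1) by (simp add: FLD1_theory_def complete_theory_def)
  have fin: "finite (dom_of I)" using d by (simp add: FLD1_decomp_def)
  have num: "num_models_of (X i) = |?Q i|" for i by (simp add: num_models_of_def num_models_def)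
  have Cprod: "Cprod (dom_of I) (\<lambda>i. num_models_of (X i)) = |?P|"
    by (simp add: Cprod_def num Field_card_of)
  \<comment> \<open>\<open>X i\<close> may be uncountable; a model on natural numbers comes from
    Loewenheim--Skolem.\<close>
  have ne: "?Q i \<noteq> {}" if "i \<in> dom_of I" for i
  proof -
    have "is_struct (X i)"
      using d that by (auto simp: FLD1_decomp_def is_struct_def has_largest_def is_po_def
          partial_order_on_def preorder_on_def)
    then have "is_model (X i) (Th (X i))" "Th (X i) \<subseteq> sentences" by (auto simp: is_model_def Th_def)
    then obtain Y :: "nat struct" where "is_model Y (Th (X i))" using model_nat by blast
    then have "iso_rel `` {Y} \<in> ?Q i" by (intro quotientI CollectI)
    then show ?thesis by (metis empty_iff)
  qed
  have comp: "|?Q i| \<le>o |?P|" if "i \<in> dom_of I" for i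
    using that ne by (rule card_of_component_le_PiE)
  obtain i where i: "i \<in> dom_of I" "natLeq <o |?Q i|" using assms(3) by (auto simp: num)
  have "natLeq <o |?P|" using i(2) comp[OF i(1)] by (rule ordLess_ordLeq_trans)
  then have "uncountable ?P" unfolding countable_iff_natLeq using not_ordLess_ordLeq by blast
  then have "|?P| \<le>o |iso_types T|" by (rule product_iso_types_le[OF d M T])
  \<comment> \<open>If one factor reaches the continuum, so does the product, and no factor exceeds
    it. Otherwise Morley bounds every factor by the first uncountable cardinal, and the product,
    being uncountable, equals it.\<close>
  moreover have "|?P| =o cardSuc natLeq \<or> |?P| =o ctwo ^c natLeq"
  proof (cases "\<exists>j\<in>dom_of I. |UNIV :: (nat \<Rightarrow> bool) set| \<le>o |?Q j|")
    case True
    then have "|UNIV :: (nat \<Rightarrow> bool) set| \<le>o |?P|" using comp ordLeq_transitive by blast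
    moreover have "|?P| \<le>o |UNIV :: (nat \<Rightarrow> bool) set|"
    proof (rule card_of_PiE_le[OF fin])
      show "infinite (UNIV :: (nat \<Rightarrow> bool) set)" by (simp add: finite_UNIV_fun)
    qed (rule iso_types_le_continuum)
    ultimately show ?thesis unfolding continuum_eq using ordIso_iff_ordLeq by blast
  next
    case False
    have le: "|?Q j| \<le>o |Field omega1|" if "j \<in> dom_of I" for j
    proof -
      have "Th (X j) \<subseteq> sentences" by (auto simp: Th_def)
      from morley[OF this] have "|?Q j| \<le>o omega1" using False that by (auto simp: num_models_def omega1_def)
      then show ?thesis using card_of_Field_ordIso[OF Card_order_omega1] ordIso_symmetric ordLeq_ordIso_trans by blast
    qed
    have "|?P| \<le>o |Field omega1|" using fin infinite_Field_omega1 le by (rule card_of_PiE_le)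
    then have "|?P| \<le>o cardSuc natLeq"
      using card_of_Field_ordIso[OF Card_order_omega1] ordLeq_ordIso_trans unfolding omega1_def by blast
    moreover have "cardSuc natLeq \<le>o |?P|"
      using \<open>natLeq <o |?P|\<close> cardSuc_ordLess_ordLeq[OF natLeq_Card_order card_of_Card_order] by blast
    ultimately show ?thesis using ordIso_iff_ordLeq by blast
  qed
  ultimately show ?thesis unfolding Cprod num_models_def by blast
qed

end
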